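(* Suppose $R$ is the indicator function of a closed convex set $M\subset\mathbb R^{m\times n}$ of the form $M=\{U\,\mathrm{diag}(\sigma)V^\top: U^\top U=I,\ V^\top V=I,\ \sigma\in K\}$, where $K\subseteq\mathbb R_+^{\min\{m,n\}}$ is convex, compact and closed under permutations of coordinates, and suppose that $\mathrm{rank}(x^* )\le s$ for some $s\ll\min\{m,n\}$. Then Algorithm 1 of the context admits an implementation, in which each $w_i$ is obtained by the low-rank weak-proximal step described in the context, such that, given the initial information $x_t,\nabla f(x_t),\nabla^2f(x_t)x_t$, each iteration requires: 1. a single rank-$s$ singular value decomposition (i.e., computing only the top $s$ components in the SVD) of a real $m\times n$ matrix; 2. a single projection computation of an $s$-dimensional vector onto an $s$-dimensional restriction $K_T$ ($|T|=s$) of the set $K$ (e.g., if $K$ is the restriction of an $\ell_p$ ball in $\mathbb R^{\min\{m,n\}}$ to the non-negative orthant, then the projection is onto the restriction of an $\ell_p$ ball to the non-negative orthant in $\mathbb R^s$); 3. a single computation of the product of $\nabla^2f(x_t)$ with a rank-$s$ $m\times n$ matrix (given by its SVD); 4. additional $O(smn)$ time.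
   Context: Problem: $\min_{x\in\mathbb R^{m\times n}}F(x)=f(x)+R(x)$, with the Euclidean (Frobenius) norm $\|\cdot\|$ and trace inner product; $R$ is proper closed convex, $f$ is convex and twice continuously differentiable over $\mathrm{dom}(R)$ with $\|\nabla^2f(x)-\nabla^2f(y)\|\le\beta_2\|x-y\|$ (induced operator norm on the left) for $x,y\in\mathrm{dom}(R)$. $F$ is bounded below with optimal value $F^*$ and unique minimizer $x^*$. One of the following holds. Assumption A: for an initialization point $x_1\in\mathrm{dom}(R)$ there are $\alpha,\beta>0$ with $\beta I\succeq\nabla^2f(x)\succeq\alpha I$ for all $x$ with $F(x)\le F(x_1)$. Assumption B: $\mathrm{dom}(R)$ has finite Euclidean diameter $D$ and $\|x-x^*\|^2\le\frac2\alpha(F(x)-F^* )$ for all $x\in\mathrm{dom}(R)$, for some $\alpha>0$; then $\beta$ denotes the Lipschitz constant of $\nabla f$ over $\mathrm{dom}(R)$. Fix $x_t\in\mathrm{dom}(R)$, an iterate of a method that started at $x_1$ and never increases $F$. Under Assumption A, $Q_t(w)=\langle w-x_t,\nabla f(x_t)\rangle+\frac12\langle w-x_t,\nabla^2f(x_t)(w-x_t)\rangle$; under Assumption B, $Q_t$ is this expression plus $\frac{\beta_2}{6}\|w-x_t\|^3$. Put $\phi_t=Q_t+R$. The constant $\tilde\beta$ denotes the Lipschitz constant of $\nabla Q_t$ over $\mathrm{dom}(R)$, and is set to $\tilde\beta=\beta$ if Assumption A holds and to $\tilde\beta=\beta+\frac{\beta_2D}{2}$ if Assumption B holds. Let $$\psi_{y,\lambda}(z)=\langle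 z-y,\nabla Q_t(y)\rangle+\frac{\lambda\tilde\beta}{2}\|z-y\|^2+R(z).$$ A first-order weak proximal oracle (WPO) for $\phi_t$ is a map which, given $(y,\lambda)\in\mathrm{dom}(R)\times\mathbb R_+$, outputs $w\in\mathrm{dom}(R)$ with $\psi_{y,\lambda}(w)\le\min\{\psi_{y,\lambda}(x^* ),\psi_{y,\lambda}(y)\}$. Algorithm 1: $y_1=x_t$; for $i=1,2,\dots$: choose $\lambda_i\in[0,1]$, let $w_i$ be the output of a WPO on input $(y_i,\lambda_i)$, and set $y_{i+1}=(1-\lambda_i)y_i+\lambda_iw_i$. Notation: $\mathrm{diag}(\sigma)$ is the $m\times n$ diagonal matrix with main diagonal $\sigma\in\mathbb R^{\min\{m,n\}}$; $U,V$ are square orthogonal of sizes $m$ and $n$. With $d=\min\{m,n\}$ and $T\subseteq[d]=\{1,\dots,d\}$, $\sigma_T\in\mathbb R^{|T|}$ is the restriction of $\sigma$ to $T$; $I_T$ is the $d\times|T|$ matrix obtained from the identity by deleting columns not indexed by $T$; $K_T=\{u\in\mathbb R^{|T|}: I_Tu\in K\}$; $\Pi_{K_T}$ is the Euclidean projection onto $K_T$. Low-rank weak-proximal step (its output is a valid output of a WPO on input $(y_i,\lambda_i)$): set $z=y_i-\frac{1}{\lambda_i\tilde\beta}\nabla Q_t(y_i)$ with SVD $z=U_z\mathrm{diag}(\sigma_z)V_z^\top$; let $T$ be a set of $s$ largest entries of $\sigma_z$; set $\sigma_z'=I_T\Pi_{K_T}[(\sigma_z)_T]$ and $z'=U_z\mathrm{diag}(\sigma_z')V_z^\top$;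 take $w_i\in\arg\min_{u\in\{y_i,z'\}}\psi_{y_i,\lambda_i}(u)$. *)

theory Defs
  imports "HOL-Analysis.Analysis"
begin

text \<open>
  The constant hidden in an O(smn) bound must not depend on m and n, so the dimensions have to be
  quantified inside the statement and cannot be types.  All real vectors (matrices) therefore live
  in one inner product space of finitely supported families indexed by nat (by nat \<times> nat);
  the d-dimensional vectors and the m \<times> n matrices are the subspaces \<open>vecs d\<close> and
  \<open>mats m n\<close> below.  Indices start at 0.
\<close>

typedef 'i fvec = "{f :: 'i \<Rightarrow> real. finite {i. f i \<noteq> 0}}"
  morphisms coord Abs_fvec
  by (rule exI[of _ "\<lambda>_. 0"]) simp

setup_lifting type_definition_fvec

instantiation fvec :: (type) real_vector
begin

lift_definition zero_fvec :: "'a fvec" is "\<lambda>_. 0" by simp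

lift_definition plus_fvec :: "'a fvec \<Rightarrow> 'a fvec \<Rightarrow> 'a fvec" is "\<lambda>f g i. f i + g i"
  subgoal for f g
    by (rule finite_subset[of _ "{i. f i \<noteq> 0} \<union> {i. g i \<noteq> 0}"]) auto
  done

lift_definition minus_fvec :: "'a fvec \<Rightarrow> 'a fvec \<Rightarrow> 'a fvec" is "\<lambda>f g i. f i - g i"
  subgoal for f g
    by (rule finite_subset[of _ "{i. f i \<noteq> 0} \<union> {i. g i \<noteq> 0}"]) auto
  done

lift_definition uminus_fvec :: "'a fvec \<Rightarrow> 'a fvec" is "\<lambda>f i. - f i"
  by simp

lift_definition scaleR_fvec :: "real \<Rightarrow> 'a fvec \<Rightarrow> 'a fvec" is "\<lambda>c f i. c * f i"
  subgoal for c f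
    by (rule finite_subset[of _ "{i. f i \<noteq> 0}"]) auto
  done

instance
  by standard (transfer; simp add: fun_eq_iff algebra_simps)+

end

instantiation fvec :: (type) real_inner
begin

definition inner_fvec :: "'a fvec \<Rightarrow> 'a fvec \<Rightarrow> real" where
  "inner_fvec x y = (\<Sum>i\<in>{i. coord x i \<noteq> 0}. coord x i * coord y i)"

definition norm_fvec :: "'a fvec \<Rightarrow> real" where
  "norm_fvec x = sqrt (inner x x)"

definition sgn_fvec :: "'a fvec \<Rightarrow> 'a fvec" where
  "sgn_fvec x = x /\<^sub>R norm x"

definition dist_fvec :: "'a fvec \<Rightarrow> 'a fvec \<Rightarrow> real" where
  "dist_fvec x y = norm (x - y)"

definition uniformity_fvec :: "('a fvec \<times> 'a fvec) filter" where
  "uniformity_fvec = (INF e\<in>{0<..}. principal {(x, y). dist x y < e})"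

definition open_fvec :: "'a fvec set \<Rightarrow> bool" where
  "open_fvec U \<longleftrightarrow> (\<forall>x\<in>U. \<forall>\<^sub>F (x', y) in uniformity. x' = x \<longrightarrow> y \<in> U)"

instance
proof
  have fin: "finite {i. coord x i \<noteq> 0}" for x :: "'a fvec"
    using coord[of x] by simp
  have inner_on: "inner x y = (\<Sum>i\<in>A. coord x i * coord y i)"
    if "finite A" "{i. coord x i \<noteq> 0} \<subseteq> A" for x y :: "'a fvec" and A
    unfolding inner_fvec_def by (rule sum.mono_neutral_left) (use that in auto)
  fix x y z :: "'a fvec" and a :: real
  show "dist x y = norm (x - y)" "sgn x = x /\<^sub>R norm x" "norm x = sqrt (inner x x)"
    by (simp_all add: dist_fvec_def sgn_fvec_def norm_fvec_def)
  show "uniformity = (INF e\<in>{0<..}. principal {(x, y :: 'a fvec). dist x y < e})"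
    by (simp add: uniformity_fvec_def)
  show "open U \<longleftrightarrow> (\<forall>x\<in>U. \<forall>\<^sub>F (x', y) in uniformity. x' = x \<longrightarrow> y \<in> U)"
    for U :: "'a fvec set"
    by (simp add: open_fvec_def)
  let ?A = "{i. coord x i \<noteq> 0} \<union> {i. coord y i \<noteq> 0}"
  have A: "finite ?A" using fin by simp
  show "inner x y = inner y x"
    using inner_on[OF A, of x y] inner_on[OF A, of y x] by (simp add: mult.commute)
  show "inner (x + y) z = inner x z + inner y z"
  proof -
    have "{i. coord (x + y) i \<noteq> 0} \<subseteq> ?A" by (auto simp: plus_fvec.rep_eq)
    then show ?thesis
      using inner_on[OF A, of x z] inner_on[OF A, of y z] inner_on[OF A, of "x + y" z]
      by (simp add: plus_fvec.rep_eq sum.distrib distrib_right)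
  qed
  show "inner (a *\<^sub>R x) y = a * inner x y"
  proof -
    have "{i. coord (a *\<^sub>R x) i \<noteq> 0} \<subseteq> {i. coord x i \<noteq> 0}"
      by (auto simp: scaleR_fvec.rep_eq)
    from inner_on[OF fin this, of y] show ?thesis
      by (simp add: scaleR_fvec.rep_eq inner_fvec_def sum_distrib_left mult.assoc)
  qed
  show "0 \<le> inner x x"
    by (simp add: inner_fvec_def sum_nonneg)
  show "inner x x = 0 \<longleftrightarrow> x = 0"
  proof -
    have "inner x x = 0 \<longleftrightarrow> (\<forall>i\<in>{i. coord x i \<noteq> 0}. coord x i * coord x i = 0)"
      unfolding inner_fvec_def by (rule sum_nonneg_eq_0_iff[OF fin]) simp
    also have "\<dots> \<longleftrightarrow> x = 0"
      by (auto simp: coord_inject[symmetric] zero_fvec.rep_eq fun_eq_iff)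
    finally show ?thesis .
  qed
qed

end

type_synonym rvec = "nat fvec"
type_synonym rmat = "(nat \<times> nat) fvec"

definition vecs :: "nat \<Rightarrow> rvec set" where
  "vecs d = {v. \<forall>i. coord v i \<noteq> 0 \<longrightarrow> i < d}"

definition mats :: "nat \<Rightarrow> nat \<Rightarrow> rmat set" where
  "mats m n = {A. \<forall>i j. coord A (i, j) \<noteq> 0 \<longrightarrow> i < m \<and> j < n}"

definition vec_of :: "nat \<Rightarrow> (nat \<Rightarrow> real) \<Rightarrow> rvec" where
  "vec_of d g = Abs_fvec (\<lambda>i. if i < d then g i else 0)"

definition mat_of :: "nat \<Rightarrow> nat \<Rightarrow> (nat \<Rightarrow> nat \<Rightarrow> real) \<Rightarrow> rmat" where
  "mat_of m n g = Abs_fvec (\<lambda>(i, j). if i < m \<and> j < n then g i j else 0)"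

lemma coord_vec_of: "coord (vec_of d g) i = (if i < d then g i else 0)"
proof -
  have "finite {i. (if i < d then g i else 0) \<noteq> 0}"
    by (rule finite_subset[of _ "{..<d}"]) (auto split: if_splits)
  then show ?thesis by (simp add: vec_of_def Abs_fvec_inverse)
qed

lemma coord_mat_of: "coord (mat_of m n g) (i, j) = (if i < m \<and> j < n then g i j else 0)"
proof -
  have "finite {k. (\<lambda>(i, j). if i < m \<and> j < n then g i j else 0) k \<noteq> 0}"
    by (rule finite_subset[of _ "{..<m} \<times> {..<n}"]) (auto split: if_splits)
  then show ?thesis by (simp add: mat_of_def Abs_fvec_inverse)
qed

text \<open>\<open>mmul m k n A B\<close> is the product of an m \<times> k and a k \<times> n matrix.\<close>

definition mmul :: "nat \<Rightarrow> nat \<Rightarrow> nat \<Rightarrow> rmat \<Rightarrow> rmat \<Rightarrow> rmat" where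
  "mmul m k n A B = mat_of m n (\<lambda>i j. \<Sum>l<k. coord A (i, l) * coord B (l, j))"

definition mvec :: "nat \<Rightarrow> nat \<Rightarrow> rmat \<Rightarrow> rvec \<Rightarrow> rvec" where
  "mvec m k A u = vec_of m (\<lambda>i. \<Sum>l<k. coord A (i, l) * coord u l)"

definition transp :: "nat \<Rightarrow> nat \<Rightarrow> rmat \<Rightarrow> rmat" where
  "transp m n A = mat_of n m (\<lambda>i j. coord A (j, i))"

definition diagm :: "nat \<Rightarrow> nat \<Rightarrow> rvec \<Rightarrow> rmat" where
  "diagm m n \<sigma> = mat_of m n (\<lambda>i j. if i = j then coord \<sigma> i else 0)"

definition mat_rank :: "nat \<Rightarrow> nat \<Rightarrow> rmat \<Rightarrow> nat" where
  "mat_rank m n A = dim ((\<lambda>j. vec_of m (\<lambda>i. coord A (i, j))) ` {..<n})"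

text \<open>m \<times> k matrices with orthonormal columns; for k = m, the orthogonal matrices\<close>

definition orth_cols :: "nat \<Rightarrow> nat \<Rightarrow> rmat \<Rightarrow> bool" where
  "orth_cols m k U \<longleftrightarrow>
     U \<in> mats m k \<and> mmul k m k (transp m k U) U = mat_of k k (\<lambda>i j. if i = j then 1 else 0)"

text \<open>
  \<open>usv m p q n U \<sigma> V\<close> is U diag(\<sigma>) V^T, where U is m \<times> p, diag(\<sigma>) is p \<times> q and V is n \<times> q.
\<close>

definition usv :: "nat \<Rightarrow> nat \<Rightarrow> nat \<Rightarrow> nat \<Rightarrow> rmat \<Rightarrow> rvec \<Rightarrow> rmat \<Rightarrow> rmat" where
  "usv m p q n U \<sigma> V = mmul m q n (mmul m p q U (diagm p q \<sigma>)) (transp n q V)"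

definition is_svd :: "nat \<Rightarrow> nat \<Rightarrow> rmat \<Rightarrow> rmat \<Rightarrow> rvec \<Rightarrow> rmat \<Rightarrow> bool" where
  "is_svd m n A U \<sigma> V \<longleftrightarrow>
     orth_cols m m U \<and> orth_cols n n V \<and> \<sigma> \<in> vecs (min m n) \<and> (\<forall>i. 0 \<le> coord \<sigma> i) \<and>
     A = usv m m n n U \<sigma> V"

definition top_entries :: "nat \<Rightarrow> nat \<Rightarrow> rvec \<Rightarrow> nat set \<Rightarrow> bool" where
  "top_entries s d \<sigma> T \<longleftrightarrow>
     T \<subseteq> {..<d} \<and> card T = s \<and> (\<forall>i\<in>T. \<forall>j\<in>{..<d} - T. coord \<sigma> j \<le> coord \<sigma> i)"

definition restrict_to :: "nat set \<Rightarrow> rvec \<Rightarrow> rvec" where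
  "restrict_to T \<sigma> = vec_of (card T) (\<lambda>k. coord \<sigma> (sorted_list_of_set T ! k))"

definition sel_mat :: "nat \<Rightarrow> nat set \<Rightarrow> rmat" where
  "sel_mat d T = mat_of d (card T) (\<lambda>i k. if i = sorted_list_of_set T ! k then 1 else 0)"

definition restrict_set :: "nat \<Rightarrow> rvec set \<Rightarrow> nat set \<Rightarrow> rvec set" where
  "restrict_set d K T = {u \<in> vecs (card T). mvec d (card T) (sel_mat d T) u \<in> K}"

text \<open>The library's \<open>closest_point\<close> is restricted to Heine-Borel spaces.\<close>

definition projection :: "rvec set \<Rightarrow> rvec \<Rightarrow> rvec" where
  "projection S v = arg_min (dist v) (\<lambda>p. p \<in> S)"

definition perm_closed :: "nat \<Rightarrow> rvec set \<Rightarrow> bool" where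
  "perm_closed d K \<longleftrightarrow>
     (\<forall>\<pi> \<sigma>. \<pi> permutes {..<d} \<longrightarrow> \<sigma> \<in> K \<longrightarrow> vec_of d (\<lambda>i. coord \<sigma> (\<pi> i)) \<in> K)"

definition spectral_set :: "nat \<Rightarrow> nat \<Rightarrow> rvec set \<Rightarrow> rmat set" where
  "spectral_set m n K =
     {usv m m n n U \<sigma> V | U \<sigma> V. orth_cols m m U \<and> orth_cols n n V \<and> \<sigma> \<in> K}"

definition indicator_fun :: "'a set \<Rightarrow> 'a \<Rightarrow> ereal" where
  "indicator_fun M x = (if x \<in> M then 0 else \<infinity>)"

definition edom :: "('a \<Rightarrow> ereal) \<Rightarrow> 'a set" where
  "edom R = {x. R x < \<infinity>}"

definition objective :: "(rmat \<Rightarrow> real) \<Rightarrow> (rmat \<Rightarrow> ereal) \<Rightarrow> rmat \<Rightarrow> ereal" where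
  "objective f R x = ereal (f x) + R x"

definition unique_minimizer :: "nat \<Rightarrow> nat \<Rightarrow> (rmat \<Rightarrow> ereal) \<Rightarrow> rmat \<Rightarrow> bool" where
  "unique_minimizer m n F x \<longleftrightarrow>
     x \<in> mats m n \<and> \<bar>F x\<bar> \<noteq> \<infinity> \<and> (\<forall>y\<in>mats m n. y \<noteq> x \<longrightarrow> F x < F y)"

text \<open>
  The Hessian is extended by 0 to the orthogonal complement of \<open>mats m n\<close>, so that the norm of the
  type of bounded linear maps is the operator norm induced by the Frobenius norm on m \<times> n matrices.
  Continuity of the Hessian is not listed because it is only used together with Lipschitz continuity.
\<close>

definition twice_differentiable ::
  "nat \<Rightarrow> nat \<Rightarrow> rmat set \<Rightarrow> (rmat \<Rightarrow> real) \<Rightarrow> (rmat \<Rightarrow> rmat) \<Rightarrow> (rmat \<Rightarrow> rmat \<Rightarrow>\<^sub>L rmat) \<Rightarrow> bool" where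
  "twice_differentiable m n S f gradf hessf \<longleftrightarrow>
     (\<forall>x\<in>S. gradf x \<in> mats m n \<and>
        (f has_derivative (\<lambda>h. inner (gradf x) h)) (at x within S) \<and>
        (\<forall>h. blinfun_apply (hessf x) h \<in> mats m n \<and>
             blinfun_apply (hessf x) h = blinfun_apply (hessf x) (mat_of m n (\<lambda>i j. coord h (i, j)))) \<and>
        (gradf has_derivative blinfun_apply (hessf x)) (at x within S))"

definition assumption_A ::
  "nat \<Rightarrow> nat \<Rightarrow> (rmat \<Rightarrow> ereal) \<Rightarrow> (rmat \<Rightarrow> rmat \<Rightarrow>\<^sub>L rmat) \<Rightarrow> rmat \<Rightarrow> real \<Rightarrow> real \<Rightarrow> bool" where
  "assumption_A m n F hessf x1 \<alpha> \<beta> \<longleftrightarrow>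
     0 < \<alpha> \<and> 0 < \<beta> \<and>
     (\<forall>x\<in>mats m n. F x \<le> F x1 \<longrightarrow> (\<forall>h\<in>mats m n.
        \<alpha> * (inner h h) \<le> inner h (blinfun_apply (hessf x) h) \<and>
        inner h (blinfun_apply (hessf x) h) \<le> \<beta> * (inner h h)))"

definition assumption_B ::
  "(rmat \<Rightarrow> ereal) \<Rightarrow> rmat set \<Rightarrow> (rmat \<Rightarrow> rmat) \<Rightarrow> rmat \<Rightarrow> real \<Rightarrow> real \<Rightarrow> bool" where
  "assumption_B F S gradf xstar \<alpha> \<beta> \<longleftrightarrow>
     0 < \<alpha> \<and> bounded S \<and>
     (\<forall>x\<in>S. ereal ((norm (x - xstar))\<^sup>2) \<le> ereal (2 / \<alpha>) * (F x - F xstar)) \<and>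
     \<beta>-lipschitz_on S gradf"

text \<open>The coefficient c is 0 for the quadratic model and \<open>\<beta>\<^sub>2\<close> for the cubically regularized one.\<close>

definition model ::
  "(rmat \<Rightarrow> rmat) \<Rightarrow> (rmat \<Rightarrow> rmat \<Rightarrow>\<^sub>L rmat) \<Rightarrow> rmat \<Rightarrow> real \<Rightarrow> rmat \<Rightarrow> real" where
  "model gradf hessf xt c w =
     inner (w - xt) (gradf xt) + 1 / 2 * inner (w - xt) (blinfun_apply (hessf xt) (w - xt))
       + c / 6 * norm (w - xt) ^ 3"

definition gradient_on :: "rmat set \<Rightarrow> (rmat \<Rightarrow> real) \<Rightarrow> rmat \<Rightarrow> rmat" where
  "gradient_on S q y = (THE g. g \<in> S \<and> (q has_derivative (\<lambda>h. inner g h)) (at y within S))"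

definition psi ::
  "(rmat \<Rightarrow> rmat) \<Rightarrow> real \<Rightarrow> (rmat \<Rightarrow> ereal) \<Rightarrow> rmat \<Rightarrow> real \<Rightarrow> rmat \<Rightarrow> ereal" where
  "psi gradQ \<beta>t R y lam z =
     ereal (inner (z - y) (gradQ y) + lam * \<beta>t / 2 * (norm (z - y))\<^sup>2) + R z"

definition wpo_output ::
  "(rmat \<Rightarrow> rmat) \<Rightarrow> real \<Rightarrow> (rmat \<Rightarrow> ereal) \<Rightarrow> rmat \<Rightarrow> rmat \<Rightarrow> real \<Rightarrow> rmat \<Rightarrow> bool" where
  "wpo_output gradQ \<beta>t R xstar y lam w \<longleftrightarrow>
     w \<in> edom R \<and>
     psi gradQ \<beta>t R y lam w \<le> min (psi gradQ \<beta>t R y lam xstar) (psi gradQ \<beta>t R y lam y)"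

definition low_rank_step ::
  "nat \<Rightarrow> nat \<Rightarrow> nat \<Rightarrow> rvec set \<Rightarrow> (rmat \<Rightarrow> rmat) \<Rightarrow> real \<Rightarrow> (rmat \<Rightarrow> ereal) \<Rightarrow> rmat \<Rightarrow> real \<Rightarrow> rmat \<Rightarrow> bool"
  where
  "low_rank_step m n s K gradQ \<beta>t R y lam w \<longleftrightarrow>
     (\<exists>U \<sigma> V T z'.
        is_svd m n (y - (1 / (lam * \<beta>t)) *\<^sub>R gradQ y) U \<sigma> V \<and>
        top_entries s (min m n) \<sigma> T \<and>
        z' = usv m m n n U
               (mvec (min m n) s (sel_mat (min m n) T)
                  (projection (restrict_set (min m n) K T) (restrict_to T \<sigma>))) V \<and>
        is_arg_min (psi gradQ \<beta>t R y lam) (\<lambda>u. u \<in> {y, z'}) w)"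

text \<open>
  Programs operate on natural-number registers (for indexing) and on arrays of real numbers.  Every
  arithmetic operation, comparison, memory access, assignment and loop iteration takes unit time.
  Registers cannot receive real data, loops are counted loops, and three oracles are available.
  A program is fixed data: it refers to the dimensions only through registers.
\<close>

type_synonym name = string

datatype iexp = INum nat | IVar name | IAdd iexp iexp | IMul iexp iexp

datatype rexp = RNum int | RGet name iexp
  | RAdd rexp rexp | RSub rexp rexp | RMul rexp rexp | RDiv rexp rexp | RSqrt rexp

datatype prog =
    Skip
  | ISet name iexp
  | RSet name iexp rexp
  | Seq prog prog
  | IfLe rexp rexp prog prog
  | For name iexp prog
  | SvdOracle name name name name
  | ProjOracle name name
  | HessOracle name name name name

record machine =
  ints :: "name \<Rightarrow> nat"
  reals :: "name \<Rightarrow> nat \<Rightarrow> real"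
  steps :: nat
  svd_calls :: nat
  proj_calls :: nat
  hess_calls :: nat

record oracles =
  dim_m :: nat
  dim_n :: nat
  dim_s :: nat
  svd_fun :: "rmat \<Rightarrow> rmat \<times> rvec \<times> rmat"
  proj_fun :: "rvec \<Rightarrow> rvec"
  hess_fun :: "rmat \<Rightarrow> rvec \<Rightarrow> rmat \<Rightarrow> rmat"

text \<open>Matrices are stored in row-major order.\<close>

definition read_mat :: "nat \<Rightarrow> nat \<Rightarrow> (nat \<Rightarrow> real) \<Rightarrow> rmat" where
  "read_mat m n a = mat_of m n (\<lambda>i j. a (i * n + j))"

definition write_mat :: "nat \<Rightarrow> nat \<Rightarrow> rmat \<Rightarrow> nat \<Rightarrow> real" where
  "write_mat m n A k = (if k < m * n then coord A (k div n, k mod n) else 0)"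

definition write_vec :: "nat \<Rightarrow> rvec \<Rightarrow> nat \<Rightarrow> real" where
  "write_vec d v k = (if k < d then coord v k else 0)"

definition write_num :: "real \<Rightarrow> nat \<Rightarrow> real" where
  "write_num c k = (if k = 0 then c else 0)"

primrec ieval :: "(name \<Rightarrow> nat) \<Rightarrow> iexp \<Rightarrow> nat" where
  "ieval I (INum k) = k"
| "ieval I (IVar x) = I x"
| "ieval I (IAdd a b) = ieval I a + ieval I b"
| "ieval I (IMul a b) = ieval I a * ieval I b"

primrec icost :: "iexp \<Rightarrow> nat" where
  "icost (INum k) = 1"
| "icost (IVar x) = 1"
| "icost (IAdd a b) = 1 + icost a + icost b"
| "icost (IMul a b) = 1 + icost a + icost b"

primrec reval :: "(name \<Rightarrow> nat) \<Rightarrow> (name \<Rightarrow> nat \<Rightarrow> real) \<Rightarrow> rexp \<Rightarrow> real" where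
  "reval I A (RNum c) = of_int c"
| "reval I A (RGet x e) = A x (ieval I e)"
| "reval I A (RAdd a b) = reval I A a + reval I A b"
| "reval I A (RSub a b) = reval I A a - reval I A b"
| "reval I A (RMul a b) = reval I A a * reval I A b"
| "reval I A (RDiv a b) = reval I A a / reval I A b"
| "reval I A (RSqrt a) = sqrt (reval I A a)"

primrec rcost :: "rexp \<Rightarrow> nat" where
  "rcost (RNum c) = 1"
| "rcost (RGet x e) = 1 + icost e"
| "rcost (RAdd a b) = 1 + rcost a + rcost b"
| "rcost (RSub a b) = 1 + rcost a + rcost b"
| "rcost (RMul a b) = 1 + rcost a + rcost b"
| "rcost (RDiv a b) = 1 + rcost a + rcost b"
| "rcost (RSqrt a) = 1 + rcost a"

definition tick :: "nat \<Rightarrow> machine \<Rightarrow> machine" where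
  "tick k st = st\<lparr>steps := steps st + k\<rparr>"

primrec exec :: "oracles \<Rightarrow> prog \<Rightarrow> machine \<Rightarrow> machine" where
  "exec E Skip st = tick 1 st"
| "exec E (ISet x e) st = tick (1 + icost e) (st\<lparr>ints := (ints st)(x := ieval (ints st) e)\<rparr>)"
| "exec E (RSet x e r) st = tick (1 + icost e + rcost r)
     (st\<lparr>reals := (reals st)(x := (reals st x)
           (ieval (ints st) e := reval (ints st) (reals st) r))\<rparr>)"
| "exec E (Seq p q) st = exec E q (exec E p st)"
| "exec E (IfLe a b p q) st =
     (if reval (ints st) (reals st) a \<le> reval (ints st) (reals st) b then exec E p else exec E q)
       (tick (1 + rcost a + rcost b) st)"
| "exec E (For x e p) st =
     fold (\<lambda>k st'. exec E p (tick 1 (st'\<lparr>ints := (ints st')(x := k)\<rparr>)))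
       [0..<ieval (ints st) e] (tick (1 + icost e) st)"
| "exec E (SvdOracle a u g v) st =
     (case svd_fun E (read_mat (dim_m E) (dim_n E) (reals st a)) of (U, \<sigma>, V) \<Rightarrow>
        tick 1 (st\<lparr>svd_calls := Suc (svd_calls st),
          reals := (reals st)(u := write_mat (dim_m E) (dim_s E) U, g := write_vec (dim_s E) \<sigma>,
                              v := write_mat (dim_n E) (dim_s E) V)\<rparr>))"
| "exec E (ProjOracle a b) st =
     tick 1 (st\<lparr>proj_calls := Suc (proj_calls st),
       reals := (reals st)(b := write_vec (dim_s E) (proj_fun E (vec_of (dim_s E) (reals st a))))\<rparr>)"
| "exec E (HessOracle u g v b) st =
     tick 1 (st\<lparr>hess_calls := Suc (hess_calls st),
       reals := (reals st)(b := write_mat (dim_m E) (dim_n E)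
         (hess_fun E (read_mat (dim_m E) (dim_s E) (reals st u)) (vec_of (dim_s E) (reals st g))
            (read_mat (dim_n E) (dim_s E) (reals st v))))\<rparr>)"

text \<open>
  The rank-s SVD oracle returns s leading components of some SVD (which one is unspecified); by
  permuting components, the leading ones are taken to be those with indices below s.
\<close>

definition svd_oracle :: "nat \<Rightarrow> nat \<Rightarrow> nat \<Rightarrow> (rmat \<Rightarrow> rmat \<times> rvec \<times> rmat) \<Rightarrow> bool" where
  "svd_oracle m n s svd \<longleftrightarrow>
     (\<forall>A\<in>mats m n. \<exists>U \<sigma> V. is_svd m n A U \<sigma> V \<and> top_entries s (min m n) \<sigma> {..<s} \<and>
        svd A = (mat_of m s (\<lambda>i k. coord U (i, k)), vec_of s (coord \<sigma>),
                 mat_of n s (\<lambda>i k. coord V (i, k))))"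

text \<open>
  As K is closed under permutations, \<open>restrict_set (min m n) K T\<close> is the same set for all T with s
  elements.
\<close>

definition proj_oracle :: "nat \<Rightarrow> nat \<Rightarrow> nat \<Rightarrow> rvec set \<Rightarrow> (rvec \<Rightarrow> rvec) \<Rightarrow> bool" where
  "proj_oracle m n s K pr \<longleftrightarrow>
     (\<forall>v\<in>vecs s. pr v = projection (restrict_set (min m n) K {..<s}) v)"

definition hess_oracle ::
  "nat \<Rightarrow> nat \<Rightarrow> nat \<Rightarrow> (rmat \<Rightarrow>\<^sub>L rmat) \<Rightarrow> (rmat \<Rightarrow> rvec \<Rightarrow> rmat \<Rightarrow> rmat) \<Rightarrow> bool" where
  "hess_oracle m n s H hp \<longleftrightarrow>
     (\<forall>U \<sigma> V. orth_cols m s U \<and> orth_cols n s V \<and> \<sigma> \<in> vecs s \<and> (\<forall>i. 0 \<le> coord \<sigma> i) \<longrightarrow>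
        hp U \<sigma> V = blinfun_apply H (usv m s s n U \<sigma> V))"

text \<open>
  The input consists of the dimensions, x_t, the gradient g and the Hessian-vector product hx at
  x_t, and the scalars \<open>\<beta>t\<close> and c; the step size is written into the cell lam before each iteration.
\<close>

definition input_state ::
  "nat \<Rightarrow> nat \<Rightarrow> nat \<Rightarrow> rmat \<Rightarrow> rmat \<Rightarrow> rmat \<Rightarrow> real \<Rightarrow> real \<Rightarrow> machine" where
  "input_state m n s xt g hx \<beta>t c =
     \<lparr>ints = (\<lambda>_. 0)(''m'' := m, ''n'' := n, ''s'' := s),
      reals = (\<lambda>_ _. 0)(''x'' := write_mat m n xt, ''g'' := write_mat m n g,
                        ''hx'' := write_mat m n hx,
                        ''beta'' := write_num \<beta>t, ''cubic'' := write_num c),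
      steps = 0, svd_calls = 0, proj_calls = 0, hess_calls = 0\<rparr>"

definition start_iteration :: "real \<Rightarrow> machine \<Rightarrow> machine" where
  "start_iteration lam st =
     st\<lparr>reals := (reals st)(''lam'' := write_num lam),
        steps := 0, svd_calls := 0, proj_calls := 0, hess_calls := 0\<rparr>"

text \<open>
  \<open>run E init body lam st i\<close> is the machine after i iterations.  The counters of
  \<open>run E init body lam st (Suc i)\<close> are the costs of the last iteration alone.
\<close>

primrec run :: "oracles \<Rightarrow> prog \<Rightarrow> prog \<Rightarrow> (nat \<Rightarrow> real) \<Rightarrow> machine \<Rightarrow> nat \<Rightarrow> machine" where
  "run E init body lam st 0 = exec E init st"
| "run E init body lam st (Suc i) = exec E body (start_iteration (lam i) (run E init body lam st i))"

end

theory Submission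
  imports Defs
begin

text \<open>
  Completing the square in \<open>\<psi>\<close> shows that the weak proximal step only has to produce a point of M
  that is no farther from z than \<open>x\<^sup>*\<close> is.  If x in M has rank at most s, von Neumann's trace
  inequality bounds \<open>\<langle>x, z\<rangle>\<close> by the scalar product of the singular values of z with a
  rearrangement, supported on T, of those of x.  That rearrangement lies in the restriction of K,
  so projecting the s leading singular values onto the restriction gives a point at least as close
  to z.

  The gradient of the model involves the Hessian only through its products with \<open>x\<^sub>t\<close> and with
  the current iterate.  The iterates are convex combinations of \<open>x\<^sub>t\<close> and earlier candidates, so
  their products are updated by the same convex combinations, and each iteration needs one new
  product, that with its rank-s candidate.

  The Hessian is a derivative within M only, and its symmetry is needed to differentiate the model:
  comparing second differences gives symmetry on the differences of points of M, and these span
  all matrices unless M is a point.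
\<close>

subsection \<open>Finitely supported vectors and matrices\<close>

text \<open>The trace inequality is obtained without Birkhoff's theorem. Only the first
  \<open>min m n\<close> columns of the orthogonal factors meet the diagonal, so the squared
  overlaps of singular vectors form a matrix whose row and column sums are at most 1, not a doubly
  stochastic one. Summation by parts and a threshold argument handle such matrices directly. The
  rank bound enters through the support: at most s singular values of x are nonzero, so the
  rearrangement that aligns them with the singular values of z can be kept within the s leading
  positions, and permutation invariance keeps it in K. This is why a rank-s decomposition of z
  carries all the information that the step needs. The machine decides between candidate and current
  point by a sign test, because \<psi> vanishes at the current point. The constant 226 is the sum of
  the cost bounds of the blocks of one iteration; lower-order terms are absorbed by s m n, which is
  at least 1.\<close>

lemma coord_zero [simp]: "coord 0 i = 0"
  by (simp add: zero_fvec.rep_eq)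

lemma coord_add [simp]: "coord (x + y) i = coord x i + coord y i"
  by (simp add: plus_fvec.rep_eq)

lemma coord_diff [simp]: "coord (x - y) i = coord x i - coord y i"
  by (simp add: minus_fvec.rep_eq)

lemma coord_scaleR [simp]: "coord (c *\<^sub>R x) i = c * coord x i"
  by (simp add: scaleR_fvec.rep_eq)

lemma coord_sum [simp]: "coord (\<Sum>a\<in>A. f a) i = (\<Sum>a\<in>A. coord (f a) i)"
  by (induction A rule: infinite_finite_induct) auto

lemma fvec_eqI: "(\<And>i. coord x i = coord y i) \<Longrightarrow> x = y"
  by (simp add: coord_inject[symmetric] fun_eq_iff)

lemma inner_fvec_superset:
  assumes "finite A" "\<And>i. i \<notin> A \<Longrightarrow> coord x i = 0"
  shows "inner x y = (\<Sum>i\<in>A. coord x i * coord y i)"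
  unfolding inner_fvec_def by (rule sum.mono_neutral_left) (use assms in auto)

lemma vecs_outside: "v \<in> vecs d \<Longrightarrow> d \<le> i \<Longrightarrow> coord v i = 0"
  unfolding vecs_def by force

lemma mats_outside: "A \<in> mats m n \<Longrightarrow> \<not> (i < m \<and> j < n) \<Longrightarrow> coord A (i, j) = 0"
  unfolding mats_def by blast

lemma inner_vecs: "v \<in> vecs d \<Longrightarrow> inner v u = (\<Sum>i<d. coord v i * coord u i)"
  by (rule inner_fvec_superset) (auto intro: vecs_outside)

lemma inner_mats:
  assumes "A \<in> mats m n"
  shows "inner A B = (\<Sum>i<m. \<Sum>j<n. coord A (i, j) * coord B (i, j))"
proof -
  have "inner A B = (\<Sum>p\<in>{..<m} \<times> {..<n}. coord A p * coord B p)"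
    by (rule inner_fvec_superset) (use mats_outside[OF assms] in auto)
  also have "\<dots> = (\<Sum>i<m. \<Sum>j<n. coord A (i, j) * coord B (i, j))"
    by (simp add: sum.cartesian_product case_prod_unfold)
  finally show ?thesis .
qed

lemma vec_of_in_vecs [simp]: "vec_of d g \<in> vecs d"
  by (simp add: vecs_def coord_vec_of)

lemma mat_of_in_mats [simp]: "mat_of m n g \<in> mats m n"
  by (simp add: mats_def coord_mat_of)

lemma mats_eqI:
  assumes "A \<in> mats m n" "B \<in> mats m n"
    and "\<And>i j. i < m \<Longrightarrow> j < n \<Longrightarrow> coord A (i, j) = coord B (i, j)"
  shows "A = B"
proof (rule fvec_eqI)
  fix p show "coord A p = coord B p"
    using assms mats_outside by (cases p) metis
qed

lemma subspace_mats: "subspace (mats m n)"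
  by (auto simp: subspace_def mats_def) (metis add.right_neutral)+

text \<open>The ambient space has infinite dimension, so closedness is read off from an intersection
  of kernels of coordinate functionals, each of them an inner product with a unit vector and hence
  continuous. It makes \<open>K \<inter> vecs s\<close> compact.\<close>

lemma closed_vecs: "closed (vecs d)"
proof -
  define e :: "nat \<Rightarrow> rvec" where "e i = vec_of (Suc i) (\<lambda>j. if j = i then 1 else 0)" for i
  have "inner (e i) v = coord v i" for i v
    using inner_vecs[of "e i" "Suc i" v] by (simp add: e_def coord_vec_of)
  then have "vecs d = (\<Inter>i\<in>{d..}. {v. inner (e i) v = 0})"
    by (auto simp: vecs_def not_less[symmetric])
  moreover have "closed {v. inner (e i) v = 0}" for i
    by (intro closed_Collect_eq continuous_intros)
  ultimately show ?thesis by auto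
qed

text \<open>\<open>arg_min\<close> picks some minimizer of the distance, and compactness guarantees
  that there is one. Membership and minimality are what later arguments use.\<close>

lemma projection_works:
  assumes "compact S" "S \<noteq> {}"
  shows "projection S v \<in> S" "\<And>u. u \<in> S \<Longrightarrow> dist v (projection S v) \<le> dist v u"
proof -
  obtain p where "p \<in> S" "\<forall>u\<in>S. dist v p \<le> dist v u"
    using continuous_attains_inf[OF assms continuous_on_dist[OF continuous_on_const continuous_on_id]]
    by blast
  then have "is_arg_min (dist v) (\<lambda>p. p \<in> S) p"
    by (auto simp: is_arg_min_def not_less)
  then have "is_arg_min (dist v) (\<lambda>p. p \<in> S) (projection S v)"
    unfolding projection_def arg_min_def by (rule someI)
  then show "projection S v \<in> S" "\<And>u. u \<in> S \<Longrightarrow> dist v (projection S v) \<le> dist v u"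
    by (auto simp: is_arg_min_def not_less)
qed

subsection \<open>Singular value decompositions\<close>

text \<open>The diagonal factor collapses the double sum to the common index range. With (p, q) =
  (m, n) this describes a full decomposition, with (s, s) a thin one.\<close>

lemma coord_usv:
  "coord (usv m p q n U \<sigma> V) (i, j) =
     (if i < m \<and> j < n then \<Sum>l<min p q. coord U (i, l) * coord \<sigma> l * coord V (j, l) else 0)"
proof (cases "i < m \<and> j < n")
  case True
  have *: "(\<Sum>k<p. coord U (i, k) * (if k = l then coord \<sigma> l else 0)) =
      (if l < p then coord U (i, l) * coord \<sigma> l else 0)" for l
    by (simp add: if_distrib[of "\<lambda>x. _ * x"] cong: if_cong)
  have "coord (usv m p q n U \<sigma> V) (i, j) =
      (\<Sum>l<q. (if l < p then coord U (i, l) * coord \<sigma> l else 0) * coord V (j, l))"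
    using True by (simp add: usv_def mmul_def transp_def diagm_def coord_mat_of * cong: if_cong)
  also have "\<dots> = (\<Sum>l\<in>{..<min p q}. coord U (i, l) * coord \<sigma> l * coord V (j, l))"
    by (rule sum.mono_neutral_cong_right) auto
  finally show ?thesis using True by simp
qed (auto simp: usv_def mmul_def coord_mat_of)

lemma usv_in_mats [simp]: "usv m p q n U \<sigma> V \<in> mats m n"
  by (simp add: usv_def mmul_def)

text \<open>Columns from index s on meet zero entries of \<sigma>. This is the passage from the thin
  factors handled by the oracles to the full factors in the definition of the step.\<close>

lemma usv_truncate:
  assumes "\<sigma> \<in> vecs s" "s \<le> min p q"
  shows "usv m s s n (mat_of m s (\<lambda>i k. coord U (i, k))) \<sigma> (mat_of n s (\<lambda>i k. coord V (i, k)))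
    = usv m p q n U \<sigma> V"
proof (rule mats_eqI[of _ m n])
  fix i j assume "i < m" "j < n"
  then show "coord (usv m s s n (mat_of m s (\<lambda>i k. coord U (i, k))) \<sigma>
      (mat_of n s (\<lambda>i k. coord V (i, k)))) (i, j) = coord (usv m p q n U \<sigma> V) (i, j)"
    using assms(2) vecs_outside[OF assms(1)] unfolding coord_usv
    by (auto simp: coord_mat_of intro!: sum.mono_neutral_cong_left) (metis not_less)
qed auto

section \<open>Columns, orthonormality and rank of a factorization\<close>

definition col :: "nat \<Rightarrow> rmat \<Rightarrow> nat \<Rightarrow> rvec" where
  "col m A k = vec_of m (\<lambda>i. coord A (i, k))"

lemma coord_col: "coord (col m A k) i = (if i < m then coord A (i, k) else 0)"
  by (simp add: col_def coord_vec_of)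

lemma inner_col: "inner (col m A k) (col m B l) = (\<Sum>i<m. coord A (i, k) * coord B (i, l))"
  by (subst inner_vecs[of _ m]) (auto simp: col_def coord_vec_of)

lemma orth_cols_iff:
  "orth_cols m k U \<longleftrightarrow>
     U \<in> mats m k \<and> (\<forall>a<k. \<forall>b<k. inner (col m U a) (col m U b) = (if a = b then 1 else 0))"
proof -
  have "mmul k m k (transp m k U) U = mat_of k k (\<lambda>i j. if i = j then 1 else 0) \<longleftrightarrow>
      (\<forall>a<k. \<forall>b<k. inner (col m U a) (col m U b) = (if a = b then 1 else 0))" (is "?L = ?I \<longleftrightarrow> ?R")
  proof -
    have L: "coord ?L (a, b) = inner (col m U a) (col m U b)" if "a < k" "b < k" for a b
      using that by (simp add: mmul_def transp_def coord_mat_of inner_col)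
    have I: "coord ?I (a, b) = (if a = b then 1 else 0)" if "a < k" "b < k" for a b
      using that by (simp add: coord_mat_of)
    show ?thesis
    proof
      assume "?L = ?I" then show ?R using L I by metis
    next
      assume ?R then show "?L = ?I"
        by (intro mats_eqI[of _ k k]) (simp_all add: L I, simp_all add: mmul_def)
    qed
  qed
  then show ?thesis by (simp add: orth_cols_def)
qed

lemma orth_cols_truncate:
  assumes "orth_cols m k U" "s \<le> k"
  shows "orth_cols m s (mat_of m s (\<lambda>i l. coord U (i, l)))"
proof -
  have "col m (mat_of m s (\<lambda>i l. coord U (i, l))) a = col m U a" if "a < s" for a
    using that by (intro fvec_eqI) (simp add: coord_col coord_mat_of)
  then show ?thesis using assms by (simp add: orth_cols_iff)
qed

text \<open>The Frobenius product of two decompositions is bilinear in the singular values. Its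
  coefficients, overlaps of left times overlaps of right singular vectors, are what the trace
  inequality has to estimate.\<close>

lemma inner_usv:
  "inner (usv m m n n U \<sigma> V) (usv m m n n U' \<tau> V') =
     (\<Sum>k<min m n. \<Sum>l<min m n. coord \<sigma> k * coord \<tau> l *
        (inner (col m U k) (col m U' l) * inner (col n V k) (col n V' l)))"
proof -
  let ?d = "min m n"
  let ?t = "\<lambda>i j k l. coord U (i, k) * coord \<sigma> k * coord V (j, k) * (coord U' (i, l) * coord \<tau> l * coord V' (j, l))"
  have "inner (usv m m n n U \<sigma> V) (usv m m n n U' \<tau> V') =
      (\<Sum>i<m. \<Sum>j<n. \<Sum>k<?d. \<Sum>l<?d. ?t i j k l)"
    by (subst inner_mats[of _ m n]) (auto simp: coord_usv sum_product intro!: sum.cong)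
  also have "\<dots> = (\<Sum>i<m. \<Sum>k<?d. \<Sum>j<n. \<Sum>l<?d. ?t i j k l)"
    by (intro sum.cong refl sum.swap)
  also have "\<dots> = (\<Sum>i<m. \<Sum>k<?d. \<Sum>l<?d. \<Sum>j<n. ?t i j k l)"
    by (intro sum.cong refl sum.swap)
  also have "\<dots> = (\<Sum>k<?d. \<Sum>i<m. \<Sum>l<?d. \<Sum>j<n. ?t i j k l)"
    by (rule sum.swap)
  also have "\<dots> = (\<Sum>k<?d. \<Sum>l<?d. \<Sum>i<m. \<Sum>j<n. ?t i j k l)"
    by (intro sum.cong refl sum.swap)
  also have "\<dots> = (\<Sum>k<?d. \<Sum>l<?d. coord \<sigma> k * coord \<tau> l *
        (inner (col m U k) (col m U' l) * inner (col n V k) (col n V' l)))"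
    unfolding inner_col sum_product by (simp add: sum_distrib_left mult_ac)
  finally show ?thesis .
qed

lemma inner_usv_same:
  assumes "orth_cols m m U" "orth_cols n n V"
  shows "inner (usv m m n n U \<sigma> V) (usv m m n n U \<tau> V) = (\<Sum>k<min m n. coord \<sigma> k * coord \<tau> k)"
proof -
  have "inner (usv m m n n U \<sigma> V) (usv m m n n U \<tau> V) =
      (\<Sum>k<min m n. \<Sum>l<min m n. if k = l then coord \<sigma> k * coord \<tau> l else 0)"
    unfolding inner_usv using assms by (intro sum.cong) (auto simp: orth_cols_iff)
  then show ?thesis by simp
qed

text \<open>With \<open>v\<close> the orthogonal projection of u onto the span of the orthonormal
  family, this is nonnegativity of the squared norm of u - v. Applied to singular vectors, it bounds
  the row and column sums of squared overlaps.\<close>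

lemma bessel:
  fixes u :: "'a::real_inner"
  assumes "finite L" "\<And>a b. a \<in> L \<Longrightarrow> b \<in> L \<Longrightarrow> inner (e a) (e b) = (if a = b then 1 else 0)"
  shows "(\<Sum>l\<in>L. (inner u (e l))\<^sup>2) \<le> inner u u"
proof -
  define v where "v = (\<Sum>l\<in>L. inner u (e l) *\<^sub>R e l)"
  have uv: "inner u v = (\<Sum>l\<in>L. (inner u (e l))\<^sup>2)"
    by (simp add: v_def inner_sum_right power2_eq_square)
  have "inner v (e b) = inner u (e b)" if "b \<in> L" for b
    using assms that by (simp add: v_def inner_sum_left if_distrib[of "\<lambda>x. _ * x"] cong: if_cong)
  then have "inner v v = (\<Sum>l\<in>L. (inner u (e l))\<^sup>2)"
    by (subst (2) v_def) (simp add: inner_sum_right power2_eq_square)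
  with uv have "inner (u - v) (u - v) = inner u u - (\<Sum>l\<in>L. (inner u (e l))\<^sup>2)"
    by (simp add: inner_diff_left inner_diff_right inner_commute)
  then show ?thesis using inner_ge_zero[of "u - v"] by linarith
qed

text \<open>The matrix sends the k-th right singular vector to the k-th left one scaled by entry k
  of \<tau>. Every left singular vector with a nonzero entry therefore lies in the column space, and
  orthonormal vectors are independent.\<close>

lemma card_support_le_rank:
  assumes "orth_cols m m U" "orth_cols n n V"
  shows "card {k\<in>{..<min m n}. coord \<tau> k \<noteq> 0} \<le> mat_rank m n (usv m m n n U \<tau> V)"
proof -
  let ?x = "usv m m n n U \<tau> V" and ?S = "{k\<in>{..<min m n}. coord \<tau> k \<noteq> 0}"
  let ?C = "col m ?x ` {..<n}"
  have U: "inner (col m U a) (col m U b) = (if a = b then 1 else 0)" if "a < m" "b < m" for a b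
    using assms that by (simp add: orth_cols_iff)
  have "inj_on (col m U) {..<m}"
    using U by (intro inj_onI) (metis lessThan_iff zero_neq_one)
  then have inj: "inj_on (col m U) ?S" by (rule inj_on_subset) auto
  have indep: "independent (col m U ` ?S)"
    using U by (intro pairwise_orthogonal_independent)
      (auto simp: pairwise_def orthogonal_def, metis inner_zero_left zero_neq_one)
  have span: "col m U k \<in> span ?C" if "k \<in> ?S" for k
  proof -
    \<comment> \<open>The left side is the matrix applied to column k of V; orthonormality of the
      columns of V leaves the single term l = k.\<close>
    have "(\<Sum>j<n. coord V (j, k) *\<^sub>R col m ?x j) = coord \<tau> k *\<^sub>R col m U k"
    proof (rule fvec_eqI)
      fix i
      show "coord (\<Sum>j<n. coord V (j, k) *\<^sub>R col m ?x j) i = coord (coord \<tau> k *\<^sub>R col m U k) i"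
      proof (cases "i < m")
        case True
        have "coord (\<Sum>j<n. coord V (j, k) *\<^sub>R col m ?x j) i =
            (\<Sum>j<n. \<Sum>l<min m n. coord V (j, k) * (coord U (i, l) * coord \<tau> l * coord V (j, l)))"
          using True by (simp add: coord_col coord_usv sum_distrib_left)
        also have "\<dots> = (\<Sum>l<min m n. \<Sum>j<n. coord V (j, k) * (coord U (i, l) * coord \<tau> l * coord V (j, l)))"
          by (rule sum.swap)
        also have "\<dots> = (\<Sum>l<min m n. coord U (i, l) * coord \<tau> l * inner (col n V k) (col n V l))"
          by (simp add: inner_col sum_distrib_left mult_ac)
        also have "\<dots> = (\<Sum>l<min m n. if l = k then coord U (i, l) * coord \<tau> l else 0)"
          using that assms by (intro sum.cong) (auto simp: orth_cols_iff)
        also have "\<dots> = coord \<tau> k * coord U (i, k)" using that by simp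
        finally show ?thesis using True by (simp add: coord_col)
      qed (simp add: coord_col)
    qed
    moreover have "(\<Sum>j<n. coord V (j, k) *\<^sub>R col m ?x j) \<in> span ?C"
      by (intro span_sum span_scale span_base) auto
    ultimately have "inverse (coord \<tau> k) *\<^sub>R (coord \<tau> k *\<^sub>R col m U k) \<in> span ?C"
      by (metis span_scale)
    then show ?thesis using that by simp
  qed
  obtain B where B: "B \<subseteq> ?C" "independent B" "?C \<subseteq> span B" "card B = dim ?C"
    by (rule basis_exists)
  have "finite B" using B(1) by (rule finite_subset) simp
  moreover have "col m U ` ?S \<subseteq> span B"
    using span span_mono[OF B(3)] by (auto simp: span_span)
  ultimately have "card (col m U ` ?S) \<le> card B"
    using independent_span_bound[OF _ indep] by blast
  then have "card ?S \<le> dim ?C"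
    using B(4) card_image[OF inj] by simp
  also have "dim ?C = mat_rank m n ?x"
    unfolding mat_rank_def col_def ..
  finally show ?thesis .
qed

subsection \<open>The trace inequality for low-rank matrices\<close>

text \<open>Summation by parts in inductive form: as the partial sums of g are nonnegative, the
  factor in front of them may be lowered from \<tau> k to \<tau> (k + 1) at each step.\<close>

lemma sum_antimono_nonneg:
  fixes \<tau> g :: "nat \<Rightarrow> real"
  assumes "antimono \<tau>" "\<And>i. 0 \<le> \<tau> i" "\<And>k. k \<le> d \<Longrightarrow> 0 \<le> (\<Sum>i<k. g i)"
  shows "0 \<le> (\<Sum>i<d. \<tau> i * g i)"
proof -
  have "k \<le> d \<Longrightarrow> \<tau> k * (\<Sum>i<k. g i) \<le> (\<Sum>i<k. \<tau> i * g i)" for k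
  proof (induction k)
    case (Suc k)
    have "\<tau> (Suc k) * (\<Sum>i<Suc k. g i) \<le> \<tau> k * (\<Sum>i<Suc k. g i)"
      using antimonoD[OF assms(1), of k "Suc k"] assms(3)[OF Suc.prems] by (intro mult_right_mono) auto
    also have "\<dots> \<le> (\<Sum>i<Suc k. \<tau> i * g i)" using Suc by (simp add: distrib_left)
    finally show ?case .
  qed simp
  from this[of d] show ?thesis
    using mult_nonneg_nonneg[OF assms(2)[of d] assms(3)[of d]] by simp
qed

text \<open>By \<open>sum_antimono_nonneg\<close> it suffices to compare partial sums over i < k.
  There \<sigma> is weighted by partial column sums c j in [0, 1] of total at most k, and such
  weights do no better than weight 1 on the k largest entries.\<close>

lemma substochastic_sum_le_antimono:
  fixes \<tau> \<sigma> :: "nat \<Rightarrow> real" and D :: "nat \<Rightarrow> nat \<Rightarrow> real"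
  assumes "antimono \<tau>" "\<And>i. 0 \<le> \<tau> i" "antimono \<sigma>" "\<And>i. 0 \<le> \<sigma> i"
    and D: "\<And>i j. i < d \<Longrightarrow> j < d \<Longrightarrow> 0 \<le> D i j"
    and row: "\<And>i. i < d \<Longrightarrow> (\<Sum>j<d. D i j) \<le> 1" and column: "\<And>j. j < d \<Longrightarrow> (\<Sum>i<d. D i j) \<le> 1"
  shows "(\<Sum>i<d. \<Sum>j<d. \<tau> i * \<sigma> j * D i j) \<le> (\<Sum>i<d. \<tau> i * \<sigma> i)"
proof -
  have "0 \<le> (\<Sum>i<k. \<sigma> i - (\<Sum>j<d. \<sigma> j * D i j))" if k: "k \<le> d" for k
  proof -
    define c where "c j = (\<Sum>i<k. D i j)" for j
    have c0: "0 \<le> c j" if "j < d" for j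
      unfolding c_def using k that by (intro sum_nonneg D) auto
    have c1: "c j \<le> 1" if "j < d" for j
    proof -
      have "c j \<le> (\<Sum>i<d. D i j)"
        unfolding c_def using k that by (intro sum_mono2) (auto intro: D)
      then show ?thesis using column[OF that] by simp
    qed
    have "(\<Sum>j<d. c j) = (\<Sum>i<k. \<Sum>j<d. D i j)"
      unfolding c_def by (rule sum.swap)
    also have "\<dots> \<le> (\<Sum>i<k. 1)" using k by (intro sum_mono row) auto
    finally have ck: "(\<Sum>j<d. c j) \<le> real k" by simp
    \<comment> \<open>\<sigma> k serves as a threshold: entries before position k pay their excess
      over it at full weight, later entries do not exceed it. As the total weight is at most k, the
      thresholds cancel in the sum.\<close>
    have "\<sigma> j * c j \<le> \<sigma> k * c j + (if j < k then \<sigma> j - \<sigma> k else 0)" if "j < d" for j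
    proof (cases "j < k")
      case True
      have "(\<sigma> j - \<sigma> k) * c j \<le> (\<sigma> j - \<sigma> k) * 1"
        using antimonoD[OF assms(3), of j k] True c1[OF that] by (intro mult_left_mono) auto
      then show ?thesis using True by (simp add: algebra_simps)
    next
      case False
      then have "\<sigma> j \<le> \<sigma> k" using antimonoD[OF assms(3), of k j] by simp
      then show ?thesis using False c0[OF that] by (simp add: mult_right_mono)
    qed
    then have "(\<Sum>j<d. \<sigma> j * c j) \<le> (\<Sum>j<d. \<sigma> k * c j + (if j < k then \<sigma> j - \<sigma> k else 0))"
      by (intro sum_mono) auto
    also have "\<dots> = \<sigma> k * (\<Sum>j<d. c j) + (\<Sum>j<d. if j < k then \<sigma> j - \<sigma> k else 0)"
      by (simp add: sum.distrib sum_distrib_left)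
    also have "(\<Sum>j<d. if j < k then \<sigma> j - \<sigma> k else 0) = (\<Sum>j<k. \<sigma> j - \<sigma> k)"
      by (rule sum.mono_neutral_cong_right) (use k in auto)
    also have "\<sigma> k * (\<Sum>j<d. c j) + (\<Sum>j<k. \<sigma> j - \<sigma> k) \<le> \<sigma> k * real k + (\<Sum>j<k. \<sigma> j - \<sigma> k)"
      using ck assms(4) by (intro add_right_mono mult_left_mono) auto
    also have "\<dots> = (\<Sum>j<k. \<sigma> j)" by (simp add: sum_subtractf)
    finally have le: "(\<Sum>j<d. \<sigma> j * c j) \<le> (\<Sum>j<k. \<sigma> j)" .
    have "(\<Sum>i<k. \<Sum>j<d. \<sigma> j * D i j) = (\<Sum>j<d. \<sigma> j * c j)"
      unfolding c_def by (subst sum.swap) (simp add: sum_distrib_left)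
    with le show ?thesis by (simp add: sum_subtractf)
  qed
  from sum_antimono_nonneg[OF assms(1,2) this]
  have "0 \<le> (\<Sum>i<d. \<tau> i * (\<sigma> i - (\<Sum>j<d. \<sigma> j * D i j)))" by blast
  then show ?thesis
    by (simp add: right_diff_distrib sum_subtractf sum_distrib_left mult.assoc)
qed

text \<open>The blocks below s and from s on are sorted separately, so positions below s hold
  indices below s even when entries tie across the boundary. The hypothesis makes the concatenation
  sorted.\<close>

lemma sorting_bijection:
  fixes \<sigma> :: "nat \<Rightarrow> real"
  assumes "s \<le> d" "\<And>i j. i < s \<Longrightarrow> s \<le> j \<Longrightarrow> j < d \<Longrightarrow> \<sigma> j \<le> \<sigma> i"
  obtains \<rho> where "bij_betw \<rho> {..<d} {..<d}" "\<And>i j. i \<le> j \<Longrightarrow> j < d \<Longrightarrow> \<sigma> (\<rho> j) \<le> \<sigma> (\<rho> i)"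
    "\<And>i. i < s \<Longrightarrow> \<rho> i < s"
proof -
  define xs where "xs = sort_key (\<lambda>i. - \<sigma> i) [0..<s] @ sort_key (\<lambda>i. - \<sigma> i) [s..<d]"
  have len: "length xs = d" using assms(1) by (simp add: xs_def)
  have dist: "distinct xs" by (auto simp: xs_def)
  have set: "set xs = {..<d}"
    using ivl_disj_un_two(3)[of 0 s d] assms(1) by (simp add: xs_def atLeast0LessThan)
  have bij: "bij_betw (nth xs) {..<d} {..<d}"
    by (rule bij_betw_nth[OF dist]) (simp_all only: len set)
  have "sorted (map (\<lambda>i. - \<sigma> i) xs)"
    unfolding xs_def map_append sorted_append
    by (intro conjI sorted_sort_key ballI) (clarsimp, rule assms(2))
  then have mono: "\<sigma> (xs ! j) \<le> \<sigma> (xs ! i)" if "i \<le> j" "j < d" for i j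
    using sorted_nth_mono[of "map (\<lambda>i. - \<sigma> i) xs" i j] that len by simp
  have "xs ! i < s" if "i < s" for i
  proof -
    have "xs ! i = sort_key (\<lambda>i. - \<sigma> i) [0..<s] ! i"
      using that by (simp add: xs_def nth_append)
    also have "\<dots> \<in> set (sort_key (\<lambda>i. - \<sigma> i) [0..<s])"
      using that by (intro nth_mem) simp
    finally show ?thesis by simp
  qed
  with bij mono show ?thesis by (intro that[of "nth xs"])
qed

text \<open>With p sorting \<sigma> and q sorting \<tau>, the permutation \<pi> = q o p^(-1) pairs
  their i-th largest entries. At most s entries of \<tau> are nonzero, so its sorted form vanishes
  from position s on; since p maps the first s positions to themselves, the permuted \<tau> is
  supported below s.\<close>

lemma substochastic_sum_le_permuted:
  fixes \<tau> \<sigma> :: "nat \<Rightarrow> real" and D :: "nat \<Rightarrow> nat \<Rightarrow> real"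
  assumes "s \<le> d" and top: "\<And>i j. i < s \<Longrightarrow> s \<le> j \<Longrightarrow> j < d \<Longrightarrow> \<sigma> j \<le> \<sigma> i"
    and \<sigma>: "\<And>i. 0 \<le> \<sigma> i" and \<tau>: "\<And>i. 0 \<le> \<tau> i"
    and supp: "card {i\<in>{..<d}. \<tau> i \<noteq> 0} \<le> s"
    and D: "\<And>i j. i < d \<Longrightarrow> j < d \<Longrightarrow> 0 \<le> D i j"
    and row: "\<And>i. i < d \<Longrightarrow> (\<Sum>j<d. D i j) \<le> 1" and column: "\<And>j. j < d \<Longrightarrow> (\<Sum>i<d. D i j) \<le> 1"
  obtains \<pi> where "\<pi> permutes {..<d}" "\<And>j. s \<le> j \<Longrightarrow> j < d \<Longrightarrow> \<tau> (\<pi> j) = 0"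
    "(\<Sum>i<d. \<Sum>j<d. \<tau> i * \<sigma> j * D i j) \<le> (\<Sum>j<d. \<tau> (\<pi> j) * \<sigma> j)"
proof -
  obtain p where p: "bij_betw p {..<d} {..<d}" "\<And>i j. i \<le> j \<Longrightarrow> j < d \<Longrightarrow> \<sigma> (p j) \<le> \<sigma> (p i)"
      "\<And>i. i < s \<Longrightarrow> p i < s"
    using sorting_bijection[of s d \<sigma>, OF assms(1) top] by blast
  \<comment> \<open>With block size 0 the ordering hypothesis is vacuous, and this is plain
    sorting.\<close>
  obtain q where q: "bij_betw q {..<d} {..<d}" "\<And>i j. i \<le> j \<Longrightarrow> j < d \<Longrightarrow> \<tau> (q j) \<le> \<tau> (q i)"
    using sorting_bijection[of 0 d \<tau>] by auto
  have pd: "p i < d" and qd: "q i < d" if "i < d" for i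
    using that p(1) q(1) by (auto dest: bij_betwE)
  define p' where "p' = the_inv_into {..<d} p"
  have p'p: "p' (p i) = i" if "i < d" for i
    using that p(1) unfolding p'_def by (intro the_inv_into_f_f) (auto simp: bij_betw_def)
  have bij': "bij_betw p' {..<d} {..<d}"
    unfolding p'_def by (rule bij_betw_the_inv_into[OF p(1)])
  have pp': "p (p' j) = j" if "j < d" for j
    using that p(1) unfolding p'_def by (intro f_the_inv_into_f_bij_betw[OF p(1)]) auto
  define \<pi> where "\<pi> j = (if j < d then q (p' j) else j)" for j
  have "bij_betw \<pi> {..<d} {..<d}"
    using bij_betw_trans[OF bij' q(1)] by (rule bij_betw_cong[THEN iffD1, rotated]) (simp add: \<pi>_def)
  then have perm: "\<pi> permutes {..<d}"
    by (rule bij_imp_permutes) (simp add: \<pi>_def)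
  have zero: "\<tau> (q i) = 0" if "s \<le> i" "i < d" for i
  proof (rule ccontr)
    \<comment> \<open>A nonzero entry at a sorted position i \<ge> s would force at least i + 1 > s
      nonzero entries.\<close>
    assume nz: "\<tau> (q i) \<noteq> 0"
    have "\<tau> (q k) \<noteq> 0" if "k \<le> i" for k
      using q(2)[OF that \<open>i < d\<close>] nz \<tau>[of "q i"] by linarith
    then have "q ` {..i} \<subseteq> {i\<in>{..<d}. \<tau> i \<noteq> 0}" using qd that by auto
    then have "card (q ` {..i}) \<le> s" using supp card_mono[of "{i\<in>{..<d}. \<tau> i \<noteq> 0}" "q ` {..i}"] by simp
    moreover have "inj_on q {..i}" using q(1) that by (auto simp: bij_betw_def intro: inj_on_subset)
    ultimately show False using card_image[of q "{..i}"] that by simp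
  qed
  have "\<tau> (\<pi> j) = 0" if "s \<le> j" "j < d" for j
  proof -
    have "p' j < d" using bij' that by (auto dest: bij_betwE)
    moreover have "s \<le> p' j" using p(3)[of "p' j"] pp'[of j] that by linarith
    ultimately show ?thesis using zero that by (simp add: \<pi>_def)
  qed
  moreover
  have "(\<Sum>i<d. \<Sum>j<d. \<tau> i * \<sigma> j * D i j) \<le> (\<Sum>j<d. \<tau> (\<pi> j) * \<sigma> j)"
  proof -
    \<comment> \<open>Extension by 0 beyond d makes both sorted sequences nonincreasing on all
      natural numbers, as the sorted case demands.\<close>
    define t where "t i = (if i < d then \<tau> (q i) else 0)" for i
    define r where "r i = (if i < d then \<sigma> (p i) else 0)" for i
    have "(\<Sum>i<d. \<Sum>j<d. \<tau> i * \<sigma> j * D i j) = (\<Sum>i<d. \<Sum>j<d. \<tau> (q i) * \<sigma> j * D (q i) j)"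
      by (rule sum.reindex_bij_betw[OF q(1), symmetric])
    also have "\<dots> = (\<Sum>i<d. \<Sum>j<d. \<tau> (q i) * \<sigma> (p j) * D (q i) (p j))"
      by (intro sum.cong refl sum.reindex_bij_betw[OF p(1), symmetric])
    also have "\<dots> = (\<Sum>i<d. \<Sum>j<d. t i * r j * D (q i) (p j))"
      by (simp add: t_def r_def)
    also have "\<dots> \<le> (\<Sum>i<d. t i * r i)"
    proof (rule substochastic_sum_le_antimono)
      show "antimono t" "antimono r"
        using p(2) q(2) \<sigma> \<tau> by (auto simp: antimono_def t_def r_def)
      show "(\<Sum>j<d. D (q i) (p j)) \<le> 1" if "i < d" for i
        using row[OF qd[OF that]] sum.reindex_bij_betw[OF p(1), of "D (q i)"] by simp
      show "(\<Sum>i<d. D (q i) (p j)) \<le> 1" if "j < d" for j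
        using column[OF pd[OF that]] sum.reindex_bij_betw[OF q(1), of "\<lambda>i. D i (p j)"] by simp
    qed (auto simp: t_def r_def \<sigma> \<tau> intro!: D pd qd)
    also have "\<dots> = (\<Sum>i<d. \<tau> (\<pi> (p i)) * \<sigma> (p i))"
      using pd by (simp add: t_def r_def \<pi>_def p'p)
    also have "\<dots> = (\<Sum>j<d. \<tau> (\<pi> j) * \<sigma> j)"
      by (rule sum.reindex_bij_betw[OF p(1)])
    finally show ?thesis .
  qed
  ultimately show ?thesis using that perm by blast
qed

text \<open>A product a b of overlaps is at most (a^2 + b^2) / 2, and Bessel's inequality makes the
  matrix of these means substochastic. The rearrangement of the singular values of x produced for it
  is the required \<tau>.\<close>

lemma low_rank_trace_inequality:
  assumes "s \<le> min m n" and K: "K \<subseteq> vecs (min m n)" "\<forall>\<sigma>\<in>K. \<forall>i. 0 \<le> coord \<sigma> i" "perm_closed (min m n) K"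
    and svd: "is_svd m n z U \<sigma> V" "top_entries s (min m n) \<sigma> {..<s}"
    and x: "x \<in> spectral_set m n K" "mat_rank m n x \<le> s"
  obtains \<tau> where "\<tau> \<in> K \<inter> vecs s" "inner x x = inner \<tau> \<tau>" "inner x z \<le> inner \<tau> \<sigma>"
proof -
  let ?d = "min m n"
  obtain U' \<tau> V' where U': "orth_cols m m U'" and V': "orth_cols n n V'" and \<tau>: "\<tau> \<in> K"
      and x': "x = usv m m n n U' \<tau> V'"
    using x(1) unfolding spectral_set_def by blast
  have U: "orth_cols m m U" and V: "orth_cols n n V" and \<sigma>0: "\<And>i. 0 \<le> coord \<sigma> i"
      and z: "z = usv m m n n U \<sigma> V"
    using svd(1) by (auto simp: is_svd_def)
  define a where "a i j = inner (col m U' i) (col m U j)" for i j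
  define b where "b i j = inner (col n V' i) (col n V j)" for i j
  define D where "D i j = ((a i j)\<^sup>2 + (b i j)\<^sup>2) / 2" for i j
  have row: "(\<Sum>j<?d. D i j) \<le> 1" if "i < ?d" for i
  proof -
    have "(\<Sum>j<?d. (a i j)\<^sup>2) \<le> 1"
      using bessel[of "{..<?d}" "col m U" "col m U' i"] U U' that by (auto simp: orth_cols_iff a_def)
    moreover have "(\<Sum>j<?d. (b i j)\<^sup>2) \<le> 1"
      using bessel[of "{..<?d}" "col n V" "col n V' i"] V V' that by (auto simp: orth_cols_iff b_def)
    ultimately show ?thesis by (simp add: D_def sum.distrib sum_divide_distrib[symmetric])
  qed
  have column: "(\<Sum>i<?d. D i j) \<le> 1" if "j < ?d" for j
  proof -
    have "(\<Sum>i<?d. (a i j)\<^sup>2) \<le> 1"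
      using bessel[of "{..<?d}" "col m U'" "col m U j"] U U' that
      by (auto simp: orth_cols_iff a_def inner_commute)
    moreover have "(\<Sum>i<?d. (b i j)\<^sup>2) \<le> 1"
      using bessel[of "{..<?d}" "col n V'" "col n V j"] V V' that
      by (auto simp: orth_cols_iff b_def inner_commute)
    ultimately show ?thesis by (simp add: D_def sum.distrib sum_divide_distrib[symmetric])
  qed
  have \<tau>0: "\<And>i. 0 \<le> coord \<tau> i" using K(2) \<tau> by blast
  have top: "coord \<sigma> j \<le> coord \<sigma> i" if "i < s" "s \<le> j" "j < ?d" for i j
    using svd(2) that by (auto simp: top_entries_def)
  have "card {i\<in>{..<?d}. coord \<tau> i \<noteq> 0} \<le> s"
    using card_support_le_rank[OF U' V', of \<tau>] x(2) x' by simp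
  then obtain \<pi> where \<pi>: "\<pi> permutes {..<?d}" "\<And>j. s \<le> j \<Longrightarrow> j < ?d \<Longrightarrow> coord \<tau> (\<pi> j) = 0"
      "(\<Sum>i<?d. \<Sum>j<?d. coord \<tau> i * coord \<sigma> j * D i j) \<le> (\<Sum>j<?d. coord \<tau> (\<pi> j) * coord \<sigma> j)"
    using substochastic_sum_le_permuted[of s ?d "coord \<sigma>" "coord \<tau>" D, OF assms(1) top \<sigma>0 \<tau>0 _ _ row column]
    by (auto simp: D_def)
  define \<tau>' where "\<tau>' = vec_of ?d (\<lambda>i. coord \<tau> (\<pi> i))"
  have \<tau>'d: "\<tau>' \<in> vecs ?d" by (simp add: \<tau>'_def)
  have "\<tau>' \<in> K" using K(3) \<pi>(1) \<tau> by (auto simp: perm_closed_def \<tau>'_def)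
  moreover have "\<tau>' \<in> vecs s"
    using \<pi>(2) by (auto simp: vecs_def \<tau>'_def coord_vec_of) (meson not_le)
  moreover have "inner x x = inner \<tau>' \<tau>'"
  proof -
    have "inner x x = (\<Sum>j<?d. coord \<tau> j * coord \<tau> j)"
      unfolding x' by (rule inner_usv_same[OF U' V'])
    also have "\<dots> = (\<Sum>j<?d. coord \<tau> (\<pi> j) * coord \<tau> (\<pi> j))"
      using sum.permute[OF \<pi>(1), of "\<lambda>j. coord \<tau> j * coord \<tau> j"] by (simp add: o_def)
    also have "\<dots> = inner \<tau>' \<tau>'"
      unfolding inner_vecs[OF \<tau>'d] by (simp add: \<tau>'_def coord_vec_of)
    finally show ?thesis .
  qed
  moreover have "inner x z \<le> inner \<tau>' \<sigma>"
  proof -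
    have "inner x z = (\<Sum>i<?d. \<Sum>j<?d. coord \<tau> i * coord \<sigma> j * (a i j * b i j))"
      unfolding x' z inner_usv a_def b_def ..
    also have "\<dots> \<le> (\<Sum>i<?d. \<Sum>j<?d. coord \<tau> i * coord \<sigma> j * D i j)"
    proof (intro sum_mono mult_left_mono)
      fix i j
      have "0 \<le> (a i j - b i j)\<^sup>2" by simp
      then show "a i j * b i j \<le> D i j" by (simp add: D_def power2_diff)
    qed (use \<tau>0 \<sigma>0 in auto)
    also have "\<dots> \<le> inner \<tau>' \<sigma>"
      using \<pi>(3) unfolding inner_vecs[OF \<tau>'d] by (simp add: \<tau>'_def coord_vec_of)
    finally show ?thesis .
  qed
  ultimately show ?thesis using that by blast
qed

text \<open>For the leading index set, selection is an inclusion and restriction a truncation,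
  because \<open>vecs s\<close> and \<open>vecs d\<close> are subspaces of one type. The restricted
  set becomes a literal intersection.\<close>

lemma restrict_set_lessThan:
  assumes "s \<le> d"
  shows "restrict_set d K {..<s} = K \<inter> vecs s"
    and "u \<in> vecs s \<Longrightarrow> mvec d s (sel_mat d {..<s}) u = u"
    and "restrict_to {..<s} \<sigma> = vec_of s (coord \<sigma>)"
proof -
  have nth: "sorted_list_of_set {..<s} ! k = k" if "k < s" for k
    using that by (simp add: lessThan_atLeast0)
  show mv: "mvec d s (sel_mat d {..<s}) u = u" if "u \<in> vecs s" for u
  proof (rule fvec_eqI)
    fix i
    have "(\<Sum>l<s. (if i = sorted_list_of_set {..<s} ! l then 1 else 0) * coord u l) =
        (\<Sum>l<s. if l = i then coord u i else 0)"
      by (intro sum.cong) (auto simp: nth)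
    also have "\<dots> = coord u i" using vecs_outside[OF that, of i] by auto
    finally show "coord (mvec d s (sel_mat d {..<s}) u) i = coord u i"
      using assms vecs_outside[OF that, of i] by (simp add: mvec_def sel_mat_def coord_vec_of coord_mat_of)
  qed
  then show "restrict_set d K {..<s} = K \<inter> vecs s"
    by (auto simp: restrict_set_def)
  show "restrict_to {..<s} \<sigma> = vec_of s (coord \<sigma>)"
    by (rule fvec_eqI) (simp add: restrict_to_def coord_vec_of nth)
qed

text \<open>The candidate shares its singular vectors with z, so their inner product is that of the
  singular values. For x, the trace inequality supplies a competitor \<tau> in the set projected
  onto. Truncating \<sigma> changes the squared distances to all elements of \<open>vecs s\<close>
  by the same amount, so projecting the truncated vector suffices.\<close>

lemma truncated_projection_closest:
  assumes "s \<le> min m n" "K \<subseteq> vecs (min m n)" "\<forall>\<sigma>\<in>K. \<forall>i. 0 \<le> coord \<sigma> i" "perm_closed (min m n) K" "compact K"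
    and "is_svd m n z U \<sigma> V" "top_entries s (min m n) \<sigma> {..<s}"
    and "x \<in> spectral_set m n K" "mat_rank m n x \<le> s"
  defines "p \<equiv> projection (K \<inter> vecs s) (vec_of s (coord \<sigma>))"
  shows "p \<in> K \<inter> vecs s" "norm (usv m m n n U p V - z) \<le> norm (x - z)"
proof -
  let ?\<sigma> = "vec_of s (coord \<sigma>)"
  obtain \<tau> where \<tau>: "\<tau> \<in> K \<inter> vecs s" "inner x x = inner \<tau> \<tau>" "inner x z \<le> inner \<tau> \<sigma>"
    using low_rank_trace_inequality[OF assms(1-4,6-9)] by blast
  have "compact (K \<inter> vecs s)" by (rule compact_Int_closed[OF assms(5) closed_vecs])
  then have p: "p \<in> K \<inter> vecs s" and "dist ?\<sigma> p \<le> dist ?\<sigma> \<tau>"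
    using projection_works(1)[of "K \<inter> vecs s" ?\<sigma>] projection_works(2)[of "K \<inter> vecs s" \<tau> ?\<sigma>] \<tau>(1)
    unfolding p_def by auto
  show "p \<in> K \<inter> vecs s" by (rule p)
  from \<open>dist ?\<sigma> p \<le> dist ?\<sigma> \<tau>\<close> have "(norm (?\<sigma> - p))\<^sup>2 \<le> (norm (?\<sigma> - \<tau>))\<^sup>2" by (simp add: dist_norm power_mono)
  then have 1: "inner p p - 2 * inner p ?\<sigma> \<le> inner \<tau> \<tau> - 2 * inner \<tau> ?\<sigma>"
    by (simp add: power2_norm_eq_inner inner_diff_left inner_diff_right inner_commute)
  have 2: "inner u ?\<sigma> = inner u \<sigma>" if "u \<in> vecs s" for u
    unfolding inner_vecs[OF that] by (simp add: coord_vec_of)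
  have U: "orth_cols m m U" and V: "orth_cols n n V" and z: "z = usv m m n n U \<sigma> V"
    using assms(6) by (auto simp: is_svd_def)
  let ?z = "usv m m n n U p V"
  have pd: "p \<in> vecs (min m n)" using p assms(2) by blast
  have "inner ?z ?z - 2 * inner ?z z = inner p p - 2 * inner p \<sigma>"
    unfolding z inner_usv_same[OF U V] inner_vecs[OF pd] ..
  also have "\<dots> \<le> inner x x - 2 * inner x z" using 1 2 p \<tau> by simp
  finally have "(norm (?z - z))\<^sup>2 \<le> (norm (x - z))\<^sup>2"
    by (simp add: power2_norm_eq_inner inner_diff_left inner_diff_right inner_commute)
  then show "norm (?z - z) \<le> norm (x - z)" by (rule power2_le_imp_le) simp
qed

subsection \<open>The gradient of the model\<close>

text \<open>The second-difference argument, kept inside the triangle with vertices x, p and q: the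
  quotient \<open>\<Delta> u v t / t\<^sup>2\<close> tends to the inner product of H v and u, while
  \<Delta> is symmetric in u and v. The error is controlled by differentiability of g at x within
  S.\<close>

lemma second_derivative_symmetric:
  fixes f :: "'a::real_inner \<Rightarrow> real" and g :: "'a \<Rightarrow> 'a"
  assumes S: "convex S" "x \<in> S" "p \<in> S" "q \<in> S"
    and f: "\<And>z. z \<in> S \<Longrightarrow> (f has_derivative (\<lambda>h. inner (g z) h)) (at z within S)"
    and g: "(g has_derivative H) (at x within S)"
  shows "inner (H (q - x)) (p - x) = inner (H (p - x)) (q - x)"
proof -
  interpret H: bounded_linear H using g by (rule has_derivative_bounded_linear)
  define \<Delta> where "\<Delta> u v t = f (x + t *\<^sub>R u + t *\<^sub>R v) - f (x + t *\<^sub>R u) - f (x + t *\<^sub>R v) + f x" for u v and t :: real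
  have second_difference: "\<exists>\<delta>>0. \<forall>t. 0 < t \<and> t < \<delta> \<longrightarrow>
      \<bar>\<Delta> (p - x) (q - x) t / t\<^sup>2 - inner (H (q - x)) (p - x)\<bar> \<le> e"
    if "p \<in> S" "q \<in> S" "0 < e" for p q e
  proof -
    define u v where "u = p - x" and "v = q - x"
    \<comment> \<open>A point of the triangle: weight 1 - (a + b) on x, the rest on a convex
      combination of p and q. The case a + b = 0 is split off to allow division.\<close>
    have inS: "x + a *\<^sub>R u + b *\<^sub>R v \<in> S" if "0 \<le> a" "0 \<le> b" "a + b \<le> 1" for a b :: real
    proof -
      show ?thesis
      proof (cases "a + b = 0")
        case True
        then show ?thesis using that S(2) by (simp add: add_nonneg_eq_0_iff)
      next
        case False
        then have ab: "0 < a + b" using that by linarith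
        have "(a / (a + b)) *\<^sub>R p + (b / (a + b)) *\<^sub>R q \<in> S"
          using ab that by (intro convexD[OF S(1) \<open>p \<in> S\<close> \<open>q \<in> S\<close>]) (auto simp: add_divide_distrib[symmetric])
        from convexD[OF S(1,2) this, of "1 - (a + b)" "a + b"] that
        have "(1 - (a + b)) *\<^sub>R x + (a + b) *\<^sub>R ((a / (a + b)) *\<^sub>R p + (b / (a + b)) *\<^sub>R q) \<in> S"
          by simp
        then have "(1 - (a + b)) *\<^sub>R x + (a *\<^sub>R p + b *\<^sub>R q) \<in> S"
          using ab by (simp add: scaleR_add_right)
        then show ?thesis by (simp add: u_def v_def algebra_simps)
      qed
    qed
    define N where "N = norm u + norm v + 1"
    have N: "0 < N" "norm u \<le> N" "norm v \<le> N" by (auto simp: N_def add_nonneg_pos)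
    \<comment> \<open>The remainder of g occurs at displacements of length at most 2 t N and t N and
      is then paired with u, of norm at most N; dividing by 3 N N leaves a final error of e.\<close>
    define e' where "e' = e / (3 * N * N)"
    have "0 < e'" using \<open>0 < e\<close> N by (simp add: e'_def)
    then obtain d where d: "0 < d" "\<And>z. z \<in> S \<Longrightarrow> norm (z - x) < d \<Longrightarrow>
        norm (g z - g x - H (z - x)) \<le> e' * norm (z - x)"
      using g unfolding has_derivative_within_alt by blast
    have est: "norm (g (x + h) - g x - H h) \<le> e' * norm h" if "x + h \<in> S" "norm h < d" for h
      using d(2)[of "x + h"] that by simp
    \<comment> \<open>The bound 1/2 keeps r + t \<le> 1 for all r \<le> t, and d / (2 N) keeps both
      displacements shorter than d.\<close>
    define \<delta> where "\<delta> = min (1/2) (d / (2 * N))"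
    have "0 < \<delta>" using d N by (simp add: \<delta>_def)
    moreover have "\<bar>\<Delta> u v t / t\<^sup>2 - inner (H v) u\<bar> \<le> e" if t: "0 < t" "t < \<delta>" for t
    proof -
      have t2: "t \<le> 1/2" and td: "t * (2 * N) < d" using t N by (auto simp: \<delta>_def field_simps)
      \<comment> \<open>Freezing the step in direction v turns \<Delta> into the increment of a
        function of one real variable, to which the mean value theorem applies.\<close>
      define G where "G r = f (x + r *\<^sub>R u + t *\<^sub>R v) - f (x + r *\<^sub>R u)" for r
      let ?G' = "\<lambda>r h. inner (g (x + r *\<^sub>R u + t *\<^sub>R v)) (h *\<^sub>R u) - inner (g (x + r *\<^sub>R u)) (h *\<^sub>R u)"
      have "(G has_derivative ?G' r) (at r within {0..t})" if "0 \<le> r" "r \<le> t" for r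
        unfolding G_def
      proof (rule has_derivative_diff)
        show "((\<lambda>r. f (x + r *\<^sub>R u + t *\<^sub>R v)) has_derivative
            (\<lambda>h. inner (g (x + r *\<^sub>R u + t *\<^sub>R v)) (h *\<^sub>R u))) (at r within {0..t})"
          using that t t2 inS by (intro has_derivative_in_compose2[OF f]) (auto intro!: derivative_eq_intros)
        show "((\<lambda>r. f (x + r *\<^sub>R u)) has_derivative
            (\<lambda>h. inner (g (x + r *\<^sub>R u)) (h *\<^sub>R u))) (at r within {0..t})"
          using that t t2 inS[of _ 0] by (intro has_derivative_in_compose2[OF f]) (auto intro!: derivative_eq_intros)
      qed
      from mvt_very_simple[of 0 t G ?G', OF _ this] t
      obtain r where r: "0 \<le> r" "r \<le> t" "G t - G 0 = ?G' r t" by auto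
      let ?a = "r *\<^sub>R u + t *\<^sub>R v" and ?b = "r *\<^sub>R u"
      define w where "w = (g (x + ?a) - g x - H ?a) - (g (x + ?b) - g x - H ?b)"
      have nb: "norm ?b \<le> t * N" using r t N by (auto intro!: mult_mono)
      have "norm ?a \<le> norm ?b + norm (t *\<^sub>R v)" by (rule norm_triangle_ineq)
      also have "\<dots> \<le> t * N + t * N" using nb t N by (intro add_mono) (auto intro!: mult_mono)
      finally have na: "norm ?a \<le> 2 * (t * N)" by (simp add: mult.commute)
      have "norm w \<le> norm (g (x + ?a) - g x - H ?a) + norm (g (x + ?b) - g x - H ?b)"
        unfolding w_def by (rule norm_triangle_ineq4)
      also have "\<dots> \<le> e' * norm ?a + e' * norm ?b"
      proof (intro add_mono est)
        show "norm ?a < d" "norm ?b < d" using na nb td mult_pos_pos[OF t(1) N(1)] by linarith+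
        show "x + ?a \<in> S" "x + ?b \<in> S"
          using inS[of r t] inS[of r 0] r t t2 by (auto simp: add.assoc)
      qed
      also have "\<dots> \<le> e' * (2 * (t * N)) + e' * (t * N)"
        using na nb \<open>0 < e'\<close> by (intro add_mono mult_left_mono) auto
      finally have nw: "norm w \<le> 3 * e' * t * N" by (simp add: mult_ac)
      have "\<Delta> u v t = G t - G 0" by (simp add: \<Delta>_def G_def)
      also have "\<dots> = t * inner (g (x + ?a) - g (x + ?b)) u"
        using r(3) by (simp add: inner_diff_left right_diff_distrib add.assoc)
      \<comment> \<open>The two expansions share \<open>g x\<close> and the contribution of r u, so
        beside the remainders only the contribution of t v survives.\<close>
      also have "g (x + ?a) - g (x + ?b) = w + t *\<^sub>R H v"
        by (simp add: w_def H.add H.scaleR)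
      finally have "\<Delta> u v t = t\<^sup>2 * inner (H v) u + t * inner w u"
        by (simp add: inner_add_left power2_eq_square algebra_simps)
      then have "\<Delta> u v t / t\<^sup>2 - inner (H v) u = inner w u / t"
        using t by (simp add: field_simps power2_eq_square)
      moreover have "\<bar>inner w u\<bar> \<le> (3 * e' * t * N) * N"
        using Cauchy_Schwarz_ineq2[of w u] mult_mono[OF nw N(2)] \<open>0 < e'\<close> t N by force
      moreover have "(3 * e' * t * N) * N = e * t" using N by (simp add: e'_def)
      ultimately show ?thesis using t by (simp add: divide_le_eq)
    qed
    ultimately show ?thesis unfolding u_def v_def by blast
  qed
  have comm: "\<Delta> u v t = \<Delta> v u t" for u v t
    by (simp add: \<Delta>_def add.commute add.left_commute)
  have "\<bar>inner (H (q - x)) (p - x) - inner (H (p - x)) (q - x)\<bar> \<le> 0 + e" if "0 < e" for e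
  proof -
    have "0 < e / 2" using that by simp
    obtain d1 where d1: "0 < d1" "\<And>t. 0 < t \<Longrightarrow> t < d1 \<Longrightarrow>
        \<bar>\<Delta> (p - x) (q - x) t / t\<^sup>2 - inner (H (q - x)) (p - x)\<bar> \<le> e / 2"
      using second_difference[OF S(3,4) \<open>0 < e / 2\<close>] by blast
    obtain d2 where d2: "0 < d2" "\<And>t. 0 < t \<Longrightarrow> t < d2 \<Longrightarrow>
        \<bar>\<Delta> (q - x) (p - x) t / t\<^sup>2 - inner (H (p - x)) (q - x)\<bar> \<le> e / 2"
      using second_difference[OF S(4,3) \<open>0 < e / 2\<close>] by blast
    define t where "t = min d1 d2 / 2"
    have "0 < t" "t < d1" "t < d2" using d1(1) d2(1) by (auto simp: t_def)
    with d1(2)[of t] d2(2)[of t] show ?thesis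
      unfolding comm[of "q - x" "p - x"] by linarith
  qed
  then have "\<bar>inner (H (q - x)) (p - x) - inner (H (p - x)) (q - x)\<bar> \<le> 0"
    by (rule field_le_epsilon)
  then show ?thesis by simp
qed

text \<open>Permutation matrices with one sign changed generate, through their differences, every matrix unit.\<close>

lemma matrix_unit_spectral_difference:
  assumes "\<sigma> \<in> K" "k < min m n" "i < m" "j < n"
  obtains A B where "A \<in> spectral_set m n K" "B \<in> spectral_set m n K"
    "A - B = (2 * coord \<sigma> k) *\<^sub>R mat_of m n (\<lambda>a b. if a = i \<and> b = j then 1 else 0)"
proof -
  \<comment> \<open>Column k is e times the unit vector c, and the other columns are unsigned
    permuted unit vectors. Switching the sign in the left factor therefore alters only the k-th
    singular component, which sits at position (i, j) and changes by 2 \<sigma>_k.\<close>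
  define P where "P d c e = mat_of d d (\<lambda>a b. if a = Transposition.transpose k c b then (if b = k then e else 1) else 0)"
    for d c and e :: real
  have orth: "orth_cols d d (P d c e)" if "c < d" "k < d" "e * e = 1" for d c e
  proof -
    have lt: "Transposition.transpose k c b < d" if "b < d" for b
      using that \<open>c < d\<close> \<open>k < d\<close> by (auto simp: Transposition.transpose_def)
    have "inner (col d (P d c e) b) (col d (P d c e) b') = (if b = b' then 1 else 0)"
      if "b < d" "b' < d" for b b'
    proof -
      have "inner (col d (P d c e) b) (col d (P d c e) b') =
          (\<Sum>a<d. if a = Transposition.transpose k c b then
             (if b = k then e else 1) * (if Transposition.transpose k c b = Transposition.transpose k c b' then (if b' = k then e else 1) else 0) else 0)"
        using that unfolding inner_col by (intro sum.cong) (auto simp: P_def coord_mat_of)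
      also have "\<dots> = (if b = b' then 1 else 0)"
        using lt[OF that(1)] \<open>e * e = 1\<close> by (auto simp: transpose_eq_iff)
      finally show ?thesis .
    qed
    then show ?thesis by (simp add: orth_cols_iff P_def)
  qed
  let ?A = "\<lambda>e. usv m m n n (P m i e) \<sigma> (P n j 1)"
  have in_set: "?A e \<in> spectral_set m n K" if "e * e = 1" for e
    using orth[of i m e] orth[of j n 1] that assms unfolding spectral_set_def by auto
  have "?A 1 - ?A (-1) = (2 * coord \<sigma> k) *\<^sub>R mat_of m n (\<lambda>a b. if a = i \<and> b = j then 1 else 0)"
  proof (rule mats_eqI[of _ m n])
    fix a b assume ab: "a < m" "b < n"
    have "coord (?A 1 - ?A (-1)) (a, b) =
        (\<Sum>l<min m n. if l = k then 2 * coord \<sigma> k * (if a = i \<and> b = j then 1 else 0) else 0)"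
      using ab unfolding coord_diff coord_usv
      by (simp only: simp_thms if_True sum_subtractf[symmetric])
        (intro sum.cong, auto simp: P_def coord_mat_of)
    also have "\<dots> = coord ((2 * coord \<sigma> k) *\<^sub>R mat_of m n (\<lambda>a b. if a = i \<and> b = j then 1 else 0)) (a, b)"
      using assms ab by (simp add: coord_mat_of)
    finally show "coord (?A 1 - ?A (-1)) (a, b) = \<dots>" .
  qed (auto intro: subspace_diff[OF subspace_mats] subspace_scale[OF subspace_mats])
  then show ?thesis using in_set[of 1] in_set[of "-1"] that by fastforce
qed

text \<open>With two distinct points present, some \<sigma> in K has a nonzero entry, since
  otherwise all elements would be 0. Each matrix unit is then a multiple of (A - x) - (B - x) with A
  and B in the set, so a linear identity on differences from x extends to all matrices.\<close>

lemma mats_subset_span_spectral_set: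
  assumes "x \<in> spectral_set m n K" "y \<in> spectral_set m n K" "x \<noteq> y"
  shows "mats m n \<subseteq> span ((\<lambda>p. p - x) ` spectral_set m n K)" (is "_ \<subseteq> span ?D")
proof -
  have "\<exists>\<sigma>\<in>K. \<exists>k<min m n. coord \<sigma> k \<noteq> 0"
  proof (rule ccontr)
    assume "\<not> ?thesis"
    then have "z = 0" if "z \<in> spectral_set m n K" for z
      using that unfolding spectral_set_def
      by (auto intro!: mats_eqI[of _ m n] sum.neutral simp: coord_usv subspace_0[OF subspace_mats])
    then show False using assms by metis
  qed
  then obtain \<sigma> k where \<sigma>: "\<sigma> \<in> K" "k < min m n" "coord \<sigma> k \<noteq> 0" by blast
  let ?e = "\<lambda>i j. mat_of m n (\<lambda>a b. if a = i \<and> b = j then 1 else 0)"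
  have e: "?e i j \<in> span ?D" if ij: "i < m" "j < n" for i j
  proof -
    obtain A B where AB: "A \<in> spectral_set m n K" "B \<in> spectral_set m n K"
        "A - B = (2 * coord \<sigma> k) *\<^sub>R ?e i j"
      by (rule matrix_unit_spectral_difference[OF \<sigma>(1,2) ij])
    have "(A - x) - (B - x) \<in> span ?D"
      by (intro span_diff span_base imageI AB)
    then have "(2 * coord \<sigma> k) *\<^sub>R ?e i j \<in> span ?D"
      unfolding AB(3)[symmetric] by simp
    then have "inverse (2 * coord \<sigma> k) *\<^sub>R (2 * coord \<sigma> k) *\<^sub>R ?e i j \<in> span ?D"
      by (rule span_scale)
    then show ?thesis using \<sigma>(3) by simp
  qed
  show ?thesis
  proof
    fix A assume A: "A \<in> mats m n"
    have "A = (\<Sum>i<m. \<Sum>j<n. coord A (i, j) *\<^sub>R ?e i j)"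
    proof (rule mats_eqI[OF A])
      show "(\<Sum>i<m. \<Sum>j<n. coord A (i, j) *\<^sub>R ?e i j) \<in> mats m n"
        by (intro subspace_sum[OF subspace_mats] subspace_scale[OF subspace_mats]) auto
      fix a b assume ab: "a < m" "b < n"
      have "coord (\<Sum>i<m. \<Sum>j<n. coord A (i, j) *\<^sub>R ?e i j) (a, b) =
          (\<Sum>i<m. \<Sum>j<n. if j = b then (if i = a then coord A (a, b) else 0) else 0)"
        using ab unfolding coord_sum by (intro sum.cong) (auto simp: coord_mat_of)
      also have "\<dots> = coord A (a, b)" using ab by simp
      finally show "coord A (a, b) = coord (\<Sum>i<m. \<Sum>j<n. coord A (i, j) *\<^sub>R ?e i j) (a, b)" by simp
    qed
    also have "\<dots> \<in> span ?D"
      by (intro span_sum span_scale e) auto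
    finally show "A \<in> span ?D" .
  qed
qed

text \<open>The norm is not differentiable at 0, the centre of the cubic term; its cube is, because
  the difference quotient there is the squared norm of h. Elsewhere the chain rule applies.\<close>

lemma has_derivative_norm_cubed:
  fixes v :: "'a::real_inner"
  shows "((\<lambda>v. norm v ^ 3) has_derivative (\<lambda>h. inner ((3 * norm v) *\<^sub>R v) h)) (at v)"
proof (cases "v = 0")
  case True
  have "((\<lambda>h::'a. norm h ^ 2) \<longlongrightarrow> norm (0::'a) ^ 2) (at 0)" by (intro tendsto_intros)
  then have "((\<lambda>h::'a. norm h ^ 2) \<longlongrightarrow> 0) (at 0)" by simp
  then have "((\<lambda>h::'a. norm h ^ 3 / norm h) \<longlongrightarrow> 0) (at 0)"
    by (rule Lim_transform_eventually)
      (auto simp: eventually_at_filter power3_eq_cube power2_eq_square)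
  then show ?thesis
    using True by (simp add: has_derivative_at bounded_linear_zero)
next
  case False
  show ?thesis
    by (rule derivative_eq_intros has_derivative_norm False refl)+
      (use False in \<open>auto simp: sgn_div_norm power2_eq_square inner_commute fun_eq_iff\<close>)
qed

text \<open>Two gradients in S differ by some v in S. Along the line y + t v, which stays in S,
  derivatives are unique, and comparing them shows that v is orthogonal to itself. Membership in S
  singles out one representative among the vectors inducing the same derivative on S.\<close>

lemma gradient_onI:
  assumes S: "subspace S" and "y \<in> S" "g \<in> S" and q: "(q has_derivative (\<lambda>h. inner g h)) (at y within S)"
  shows "gradient_on S q y = g"
  unfolding gradient_on_def
proof (rule the_equality)
  fix g' assume g': "g' \<in> S \<and> (q has_derivative (\<lambda>h. inner g' h)) (at y within S)"
  define v where "v = g' - g"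
  have v: "v \<in> S" unfolding v_def using g' assms by (intro subspace_diff) auto
  have der: "((\<lambda>t. q (y + t *\<^sub>R v)) has_derivative (\<lambda>h. inner k (h *\<^sub>R v))) (at 0)"
    if "(q has_derivative (\<lambda>h. inner k h)) (at y within S)" for k
  proof -
    have "((\<lambda>t. y + t *\<^sub>R v) has_derivative (\<lambda>h. h *\<^sub>R v)) (at 0)"
      by (auto intro!: derivative_eq_intros)
    moreover have "range (\<lambda>t. y + t *\<^sub>R v) \<subseteq> S"
      using v assms(2) by (auto intro: subspace_add[OF S] subspace_scale[OF S])
    ultimately show ?thesis
      using has_derivative_in_compose[of "\<lambda>t. y + t *\<^sub>R v" "\<lambda>h. h *\<^sub>R v" 0 UNIV q "\<lambda>h. inner k h"]
        has_derivative_subset[OF that] by simp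
  qed
  have "(\<lambda>h. inner g' (h *\<^sub>R v)) = (\<lambda>h. inner g (h *\<^sub>R v))"
    by (rule has_derivative_unique[OF der der]) (use g' q in auto)
  then have "inner g' v = inner g v" by (metis scaleR_one)
  then have "inner v v = 0" by (simp add: v_def inner_diff_left)
  then show "g' = g" by (simp add: v_def)
qed (use assms in auto)

text \<open>Differentiating the quadratic term gives the mean of the inner products of y - xt with H
  h and of h with H (y - xt); symmetry merges the two.\<close>

lemma gradient_on_model:
  assumes M: "M = spectral_set m n K" "convex M" and tw: "twice_differentiable m n M f gradf hessf"
    and xt: "xt \<in> M" and y: "y \<in> M"
  shows "gradient_on (mats m n) (model gradf hessf xt c) y =
    gradf xt + hessf xt (y - xt) + (c / 2 * norm (y - xt)) *\<^sub>R (y - xt)" (is "_ = ?g")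
proof -
  let ?H = "blinfun_apply (hessf xt)" and ?P = "\<lambda>h. mat_of m n (\<lambda>i j. coord h (i, j))"
  have Mm: "M \<subseteq> mats m n" unfolding M(1) spectral_set_def by auto
  have H: "?H h \<in> mats m n" "?H h = ?H (?P h)" and gm: "gradf xt \<in> mats m n" for h
    using tw xt unfolding twice_differentiable_def by blast+
  have fd: "(f has_derivative (\<lambda>h. inner (gradf z) h)) (at z within M)" if "z \<in> M" for z
    using tw that unfolding twice_differentiable_def by blast
  have gd: "(gradf has_derivative ?H) (at xt within M)"
    using tw xt unfolding twice_differentiable_def by blast
  \<comment> \<open>For y = xt both sides are 0; otherwise M has two points and the spanning lemma
    applies. A general h is replaced by its m x n block \<open>?P h\<close>, which changes neither
    side because H ignores the rest and takes values in \<open>mats m n\<close>.\<close>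
  have sym: "inner (y - xt) (?H h) = inner h (?H (y - xt))" for h
  proof (cases "y = xt")
    case True
    then show ?thesis by (simp add: blinfun.zero_right)
  next
    case False
    let ?S = "{h. inner (y - xt) (?H h) = inner h (?H (y - xt))}"
    have "span ((\<lambda>p. p - xt) ` M) \<subseteq> ?S"
    proof (rule span_minimal)
      show "subspace ?S"
        by (auto simp: subspace_def blinfun.bilinear_simps inner_add_left inner_add_right)
      have "inner (?H (p - xt)) (y - xt) = inner (?H (y - xt)) (p - xt)" if "p \<in> M" for p
        by (rule second_derivative_symmetric[OF M(2) xt y that fd gd])
      then show "(\<lambda>p. p - xt) ` M \<subseteq> ?S" by (auto simp: inner_commute)
    qed
    moreover have "mats m n \<subseteq> span ((\<lambda>p. p - xt) ` M)"
      using mats_subset_span_spectral_set[of xt m n K y] xt y False M(1) by auto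
    ultimately have "?P h \<in> ?S" by (meson mat_of_in_mats subsetD)
    moreover have "inner (?P h) (?H (y - xt)) = inner h (?H (y - xt))"
    proof -
      have "inner (?P h) (?H (y - xt)) = inner (?H (y - xt)) (?P h)" by (rule inner_commute)
      also have "\<dots> = inner (?H (y - xt)) h"
        unfolding inner_mats[OF H(1)] by (intro sum.cong) (auto simp: coord_mat_of)
      finally show ?thesis by (simp add: inner_commute)
    qed
    ultimately show ?thesis using H(2)[of h] by simp
  qed
  show ?thesis
  proof (rule gradient_onI[OF subspace_mats])
    show "y \<in> mats m n" using y Mm by blast
    show "?g \<in> mats m n"
      using y xt Mm H gm by (intro subspace_add subspace_scale subspace_diff subspace_mats) auto
    have id: "((\<lambda>w. w - xt) has_derivative (\<lambda>h. h)) (at y)"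
      by (auto intro!: derivative_eq_intros)
    have cub: "((\<lambda>w. norm (w - xt) ^ 3) has_derivative
        (\<lambda>h. inner ((3 * norm (y - xt)) *\<^sub>R (y - xt)) h)) (at y)"
      using has_derivative_compose[OF id has_derivative_norm_cubed] by simp
    have Hd: "((\<lambda>w. ?H (w - xt)) has_derivative ?H) (at y)"
      using bounded_linear.has_derivative[OF blinfun.bounded_linear_right id] .
    have "(model gradf hessf xt c has_derivative (\<lambda>h. inner h (gradf xt)
        + 1 / 2 * (inner (y - xt) (?H h) + inner h (?H (y - xt)))
        + c / 6 * inner ((3 * norm (y - xt)) *\<^sub>R (y - xt)) h)) (at y)"
      unfolding model_def
      by (intro has_derivative_add has_derivative_mult_right has_derivative_inner_left
          has_derivative_inner id cub Hd)
    also have "(\<lambda>h. inner h (gradf xt)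
        + 1 / 2 * (inner (y - xt) (?H h) + inner h (?H (y - xt)))
        + c / 6 * inner ((3 * norm (y - xt)) *\<^sub>R (y - xt)) h) = (\<lambda>h. inner ?g h)"
      unfolding sym by (auto simp: inner_add_left inner_add_right inner_commute fun_eq_iff)
    finally show "(model gradf hessf xt c has_derivative (\<lambda>h. inner ?g h)) (at y within mats m n)"
      by (rule has_derivative_at_withinI)
  qed
qed

subsection \<open>Execution of counted loops\<close>

text \<open>The bound is evaluated once on entry and the counter is set afresh in each round, so the
  body cannot influence the number of rounds.\<close>

lemma exec_For_invariant:
  assumes "P 0 (tick (1 + icost e) st)"
    and "\<And>k st'. k < ieval (ints st) e \<Longrightarrow> P k st' \<Longrightarrow>
      P (Suc k) (exec E p (tick 1 (st'\<lparr>ints := (ints st')(x := k)\<rparr>)))"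
  shows "P (ieval (ints st) e) (exec E (For x e p) st)"
proof -
  have "N \<le> ieval (ints st) e \<Longrightarrow>
      P N (fold (\<lambda>k st'. exec E p (tick 1 (st'\<lparr>ints := (ints st')(x := k)\<rparr>))) [0..<N] (tick (1 + icost e) st))" for N
    by (induction N) (use assms in auto)
  then show ?thesis by simp
qed

text \<open>The frame condition carried through all blocks without oracle calls. The cost is an
  upper bound, so constants may be rounded up when blocks are composed.\<close>

definition changes :: "name set \<Rightarrow> name set \<Rightarrow> nat \<Rightarrow> machine \<Rightarrow> machine \<Rightarrow> bool" where
  "changes A X c st st' \<longleftrightarrow>
     (\<forall>a. a \<notin> A \<longrightarrow> reals st' a = reals st a) \<and> (\<forall>x. x \<notin> X \<longrightarrow> ints st' x = ints st x) \<and>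
     steps st' \<le> steps st + c \<and> svd_calls st' = svd_calls st \<and>
     proj_calls st' = proj_calls st \<and> hess_calls st' = hess_calls st"

lemma changes_mono: "changes A X c st st' \<Longrightarrow> c \<le> c' \<Longrightarrow> changes A X c' st st'"
  unfolding changes_def by auto

lemma changes_trans:
  assumes "changes A X c st st'" "changes B Y c' st' st''" "A \<union> B \<subseteq> D" "X \<union> Y \<subseteq> Z" "c + c' \<le> e"
  shows "changes D Z e st st''"
  using assms unfolding changes_def by (auto; metis subsetD)

abbreviation mn :: iexp where
  "mn \<equiv> IMul (IVar ''m'') (IVar ''n'')"

definition fill :: "name \<Rightarrow> rexp \<Rightarrow> prog" where
  "fill a r = For ''k'' mn (RSet a (IVar ''k'') r)"

definition accumulate :: "name \<Rightarrow> rexp \<Rightarrow> prog" where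
  "accumulate a r = Seq (RSet a (INum 0) (RNum 0))
     (For ''k'' mn (RSet a (INum 0) (RAdd (RGet a (INum 0)) r)))"

text \<open>In round k the cell k of \<open>a\<close> still holds its old value, so the expression
  may read it; this permits the in-place updates of the iterate and of its Hessian product. Entry
  costs 4 and each round 3 + \<open>rcost r\<close>, hence the 7.\<close>

lemma exec_fill:
  assumes "ints st ''m'' = m" "ints st ''n'' = n"
    and r: "\<And>k I A. k < m * n \<Longrightarrow> I ''k'' = k \<Longrightarrow> (\<And>b. b \<noteq> a \<Longrightarrow> A b = reals st b) \<Longrightarrow>
      A a k = reals st a k \<Longrightarrow> reval I A r = \<phi> k"
    and W: "m * n \<le> W" "1 \<le> W"
  shows "changes {a} {''k''} ((7 + rcost r) * W) st (exec E (fill a r) st)"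
    and "\<forall>k<m * n. reals (exec E (fill a r) st) a k = \<phi> k"
proof -
  define P where "P K st' \<longleftrightarrow> changes {a} {''k''} (4 + K * (3 + rcost r)) st st' \<and>
      reals st' a = (\<lambda>k. if k < K then \<phi> k else reals st a k)" for K st'
  have "P (ieval (ints st) mn) (exec E (fill a r) st)"
    unfolding fill_def
  proof (rule exec_For_invariant)
    fix k st' assume k: "k < ieval (ints st) mn" and P: "P k st'"
    have "reval ((ints st')(''k'' := k)) (reals st') r = \<phi> k"
      using k P by (intro r) (auto simp: assms(1,2) P_def changes_def)
    then show "P (Suc k) (exec E (RSet a (IVar ''k'') r) (tick 1 (st'\<lparr>ints := (ints st')(''k'' := k)\<rparr>)))"
      using P by (auto simp: P_def changes_def tick_def fun_eq_iff less_Suc_eq)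
  qed (simp add: P_def changes_def tick_def)
  then have *: "changes {a} {''k''} (4 + m * n * (3 + rcost r)) st (exec E (fill a r) st)"
    "reals (exec E (fill a r) st) a = (\<lambda>k. if k < m * n then \<phi> k else reals st a k)"
    by (auto simp: P_def assms(1,2))
  have "4 * 1 + m * n * (3 + rcost r) \<le> 4 * W + W * (3 + rcost r)"
    using W by (intro add_mono mult_mono) auto
  then show "changes {a} {''k''} ((7 + rcost r) * W) st (exec E (fill a r) st)"
    by (intro changes_mono[OF *(1)]) (simp add: algebra_simps)
  show "\<forall>k<m * n. reals (exec E (fill a r) st) a k = \<phi> k" using *(2) by simp
qed

text \<open>Cell 0 of \<open>a\<close> holds the running sum, so the summand has to be determined by
  the other arrays. Set-up costs 7 and each round 6 + \<open>rcost r\<close>, hence the 13.\<close>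

lemma exec_accumulate:
  assumes "ints st ''m'' = m" "ints st ''n'' = n"
    and r: "\<And>k I A. k < m * n \<Longrightarrow> I ''k'' = k \<Longrightarrow> (\<And>b. b \<noteq> a \<Longrightarrow> A b = reals st b) \<Longrightarrow>
      reval I A r = \<phi> k"
    and W: "m * n \<le> W" "1 \<le> W"
  shows "changes {a} {''k''} ((13 + rcost r) * W) st (exec E (accumulate a r) st)"
    and "reals (exec E (accumulate a r) st) a 0 = (\<Sum>k<m * n. \<phi> k)"
proof -
  define P where "P K st' \<longleftrightarrow> changes {a} {''k''} (7 + K * (6 + rcost r)) st st' \<and>
      reals st' a 0 = (\<Sum>k<K. \<phi> k)" for K st'
  define st0 where "st0 = exec E (RSet a (INum 0) (RNum 0)) st"
  have "P (ieval (ints st0) mn) (exec E (accumulate a r) st)"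
    unfolding accumulate_def exec.simps(4) st0_def[symmetric]
  proof (rule exec_For_invariant)
    fix k st' assume k: "k < ieval (ints st0) mn" and P: "P k st'"
    have "reval ((ints st')(''k'' := k)) (reals st') r = \<phi> k"
      using k P by (intro r) (auto simp: assms(1,2) P_def changes_def st0_def tick_def)
    then show "P (Suc k) (exec E (RSet a (INum 0) (RAdd (RGet a (INum 0)) r))
        (tick 1 (st'\<lparr>ints := (ints st')(''k'' := k)\<rparr>)))"
      using P by (auto simp: P_def changes_def tick_def)
  qed (simp add: P_def changes_def tick_def st0_def)
  then have *: "changes {a} {''k''} (7 + m * n * (6 + rcost r)) st (exec E (accumulate a r) st)"
    "reals (exec E (accumulate a r) st) a 0 = (\<Sum>k<m * n. \<phi> k)"
    by (auto simp: P_def assms(1,2) st0_def tick_def)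
  have "7 * 1 + m * n * (6 + rcost r) \<le> 7 * W + W * (6 + rcost r)"
    using W by (intro add_mono mult_mono) auto
  then show "changes {a} {''k''} ((13 + rcost r) * W) st (exec E (accumulate a r) st)"
    by (intro changes_mono[OF *(1)]) (simp add: algebra_simps)
  show "reals (exec E (accumulate a r) st) a 0 = (\<Sum>k<m * n. \<phi> k)" using *(2) by simp
qed

section \<open>Entrywise evaluation of the product of the thin factors\<close>

abbreviation ent :: iexp where
  "ent \<equiv> IAdd (IMul (IVar ''i'') (IVar ''n'')) (IVar ''j'')"

definition entry_prog :: prog where
  "entry_prog = Seq (RSet ''zp'' ent (RNum 0))
     (For ''l'' (IVar ''s'') (RSet ''zp'' ent (RAdd (RGet ''zp'' ent)
        (RMul (RMul (RGet ''u'' (IAdd (IMul (IVar ''i'') (IVar ''s'')) (IVar ''l''))) (RGet ''p'' (IVar ''l'')))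
              (RGet ''v'' (IAdd (IMul (IVar ''j'') (IVar ''s'')) (IVar ''l'')))))))"

definition usv_prog :: prog where
  "usv_prog = For ''i'' (IVar ''m'') (For ''j'' (IVar ''n'') entry_prog)"

definition usv_entry :: "machine \<Rightarrow> nat \<Rightarrow> nat \<Rightarrow> nat \<Rightarrow> real" where
  "usv_entry st s i j = (\<Sum>l<s. reals st ''u'' (i * s + l) * reals st ''p'' l * reals st ''v'' (j * s + l))"

lemma usv_entry_cong: "changes {''zp''} X c st st' \<Longrightarrow> usv_entry st' s i j = usv_entry st s i j"
  by (simp add: usv_entry_def changes_def)

lemma exec_entry_prog:
  assumes "ints st ''n'' = n" "ints st ''s'' = s" "ints st ''i'' = i" "ints st ''j'' = j"
  shows "changes {''zp''} {''l''} (9 + s * 31) st (exec E entry_prog st)"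
    and "reals (exec E entry_prog st) ''zp'' = (reals st ''zp'')(i * n + j := usv_entry st s i j)"
proof -
  define P where "P K st' \<longleftrightarrow> changes {''zp''} {''l''} (9 + K * 31) st st' \<and>
      reals st' ''zp'' = (reals st ''zp'')(i * n + j :=
        (\<Sum>l<K. reals st ''u'' (i * s + l) * reals st ''p'' l * reals st ''v'' (j * s + l)))" for K st'
  define st0 where "st0 = exec E (RSet ''zp'' ent (RNum 0)) st"
  have "P (ieval (ints st0) (IVar ''s'')) (exec E entry_prog st)"
    unfolding entry_prog_def exec.simps(4) st0_def[symmetric]
  proof (rule exec_For_invariant)
    fix k st' assume "P k st'"
    then show "P (Suc k) (exec E (RSet ''zp'' ent (RAdd (RGet ''zp'' ent)
        (RMul (RMul (RGet ''u'' (IAdd (IMul (IVar ''i'') (IVar ''s'')) (IVar ''l''))) (RGet ''p'' (IVar ''l'')))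
              (RGet ''v'' (IAdd (IMul (IVar ''j'') (IVar ''s'')) (IVar ''l''))))))
        (tick 1 (st'\<lparr>ints := (ints st')(''l'' := k)\<rparr>)))"
      using assms by (auto simp: P_def changes_def tick_def)
  qed (use assms in \<open>simp add: P_def changes_def tick_def st0_def\<close>)
  then show "changes {''zp''} {''l''} (9 + s * 31) st (exec E entry_prog st)"
    "reals (exec E entry_prog st) ''zp'' = (reals st ''zp'')(i * n + j := usv_entry st s i j)"
    by (auto simp: P_def assms st0_def tick_def usv_entry_def)
qed

lemma exec_usv_row:
  fixes E :: oracles
  assumes "ints st ''n'' = n" "ints st ''s'' = s" "ints st ''i'' = i"
  defines "st' \<equiv> exec E (For ''j'' (IVar ''n'') entry_prog) st"
  shows "changes {''zp''} {''j'', ''l''} (2 + n * (10 + s * 31)) st st'"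
    and "reals st' ''zp'' =
      (\<lambda>k. if i * n \<le> k \<and> k < i * n + n then usv_entry st s i (k - i * n) else reals st ''zp'' k)"
proof -
  define P where "P K st' \<longleftrightarrow> changes {''zp''} {''j'', ''l''} (2 + K * (10 + s * 31)) st st' \<and>
      reals st' ''zp'' = (\<lambda>k. if i * n \<le> k \<and> k < i * n + K then usv_entry st s i (k - i * n) else reals st ''zp'' k)"
    for K st'
  have "P (ieval (ints st) (IVar ''n'')) st'"
    unfolding st'_def
  proof (rule exec_For_invariant)
    fix k st' assume P: "P k st'"
    let ?st = "tick 1 (st'\<lparr>ints := (ints st')(''j'' := k)\<rparr>)"
    have tick: "changes {''zp''} {''j'', ''l''} (2 + k * (10 + s * 31) + 1) st ?st"
      using P by (auto simp: P_def changes_def tick_def)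
    have i: "ints ?st ''n'' = n" "ints ?st ''s'' = s" "ints ?st ''i'' = i" "ints ?st ''j'' = k"
      using assms P by (auto simp: P_def changes_def tick_def)
    note ent = exec_entry_prog[OF i, of E]
    have "changes {''zp''} {''j'', ''l''} (2 + Suc k * (10 + s * 31)) st (exec E entry_prog ?st)"
      by (rule changes_trans[OF tick ent(1)]) auto
    moreover have "reals (exec E entry_prog ?st) ''zp'' =
        (\<lambda>q. if i * n \<le> q \<and> q < i * n + Suc k then usv_entry st s i (q - i * n) else reals st ''zp'' q)"
      unfolding ent(2) usv_entry_cong[OF tick] using P
      by (auto simp: P_def tick_def fun_eq_iff less_Suc_eq)
    ultimately show "P (Suc k) (exec E entry_prog ?st)" by (simp add: P_def)
  qed (simp add: P_def changes_def tick_def fun_eq_iff)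
  then show "changes {''zp''} {''j'', ''l''} (2 + n * (10 + s * 31)) st st'"
    "reals st' ''zp'' =
      (\<lambda>k. if i * n \<le> k \<and> k < i * n + n then usv_entry st s i (k - i * n) else reals st ''zp'' k)"
    by (auto simp: P_def assms(1))
qed

lemma exec_usv_prog:
  assumes "ints st ''m'' = m" "ints st ''n'' = n" "ints st ''s'' = s"
    and W: "s * m * n \<le> W" "m * n \<le> W" "m \<le> W" "1 \<le> W"
  shows "changes {''zp''} {''i'', ''j'', ''l''} (46 * W) st (exec E usv_prog st)"
    and "\<forall>i<m. \<forall>j<n. reals (exec E usv_prog st) ''zp'' (i * n + j) = usv_entry st s i j"
proof -
  define P where "P K st' \<longleftrightarrow> changes {''zp''} {''i'', ''j'', ''l''} (2 + K * (3 + n * (10 + s * 31))) st st' \<and>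
      (\<forall>i<K. \<forall>j<n. reals st' ''zp'' (i * n + j) = usv_entry st s i j)"
    for K st'
  have "P (ieval (ints st) (IVar ''m'')) (exec E usv_prog st)"
    unfolding usv_prog_def
  proof (rule exec_For_invariant)
    fix k st' assume P: "P k st'"
    let ?st = "tick 1 (st'\<lparr>ints := (ints st')(''i'' := k)\<rparr>)"
    let ?st' = "exec E (For ''j'' (IVar ''n'') entry_prog) ?st"
    have tick: "changes {''zp''} {''i'', ''j'', ''l''} (2 + k * (3 + n * (10 + s * 31)) + 1) st ?st"
      using P by (auto simp: P_def changes_def tick_def)
    have i: "ints ?st ''n'' = n" "ints ?st ''s'' = s" "ints ?st ''i'' = k"
      using assms P by (auto simp: P_def changes_def tick_def)
    note row = exec_usv_row[OF i, of E]
    have "changes {''zp''} {''i'', ''j'', ''l''} (2 + Suc k * (3 + n * (10 + s * 31))) st ?st'"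
      by (rule changes_trans[OF tick row(1)]) auto
    moreover have "reals ?st' ''zp'' (i * n + j) = usv_entry st s i j" if "i < Suc k" "j < n" for i j
    proof (cases "i = k")
      case True
      then show ?thesis unfolding row(2) usv_entry_cong[OF tick] using that by simp
    next
      case False
      \<comment> \<open>Rows before k end before offset k n, where row k begins, so writing row k
        leaves them intact.\<close>
      then have "Suc i * n \<le> k * n" using that by (intro mult_le_mono1) simp
      then have "i * n + j < k * n" using that by simp
      then show ?thesis unfolding row(2) using P that False by (simp add: P_def tick_def)
    qed
    ultimately show "P (Suc k) ?st'" by (simp add: P_def)
  qed (simp add: P_def changes_def tick_def)
  then have *: "changes {''zp''} {''i'', ''j'', ''l''} (2 + m * (3 + n * (10 + s * 31))) st (exec E usv_prog st)"
    "\<forall>i<m. \<forall>j<n. reals (exec E usv_prog st) ''zp'' (i * n + j) = usv_entry st s i j"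
    by (auto simp: P_def assms(1))
  \<comment> \<open>Each of 1, m, m n and s m n is at most W, and 2 + 3 + 10 + 31 = 46.\<close>
  have "2 + m * (3 + n * (10 + s * 31)) = 2 + 3 * m + 10 * (m * n) + 31 * (s * m * n)"
    by (simp add: algebra_simps)
  also have "\<dots> \<le> 46 * W" using W by linarith
  finally show "changes {''zp''} {''i'', ''j'', ''l''} (46 * W) st (exec E usv_prog st)"
    by (rule changes_mono[OF *(1)])
  show "\<forall>i<m. \<forall>j<n. reals (exec E usv_prog st) ''zp'' (i * n + j) = usv_entry st s i j" by (rule *(2))
qed

subsection \<open>Matrices in row-major storage\<close>

lemma row_major_less: "i < m \<Longrightarrow> j < n \<Longrightarrow> i * n + j < m * (n::nat)"
proof -
  assume "i < m" "j < n"
  then have "Suc i * n \<le> m * n" by (intro mult_le_mono1) simp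
  with \<open>j < n\<close> show ?thesis by simp
qed

lemma coord_read_mat: "coord (read_mat m n a) (i, j) = (if i < m \<and> j < n then a (i * n + j) else 0)"
  by (simp add: read_mat_def coord_mat_of)

lemma read_mat_in_mats [simp]: "read_mat m n a \<in> mats m n"
  by (simp add: read_mat_def)

lemma read_write_mat: "A \<in> mats m n \<Longrightarrow> read_mat m n (write_mat m n A) = A"
  by (rule mats_eqI[of _ m n]) (auto simp: coord_read_mat write_mat_def row_major_less)

lemma vec_of_write_vec: "v \<in> vecs d \<Longrightarrow> vec_of d (write_vec d v) = v"
  by (rule fvec_eqI) (auto simp: coord_vec_of write_vec_def vecs_outside)

lemma read_mat_cong: "(\<And>k. k < m * n \<Longrightarrow> a k = b k) \<Longrightarrow> read_mat m n a = read_mat m n b"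
  by (rule mats_eqI[of _ m n]) (auto simp: coord_read_mat row_major_less)

lemma read_mat_add: "read_mat m n (\<lambda>k. a k + b k) = read_mat m n a + read_mat m n b"
  and read_mat_diff: "read_mat m n (\<lambda>k. a k - b k) = read_mat m n a - read_mat m n b"
  and read_mat_scale: "read_mat m n (\<lambda>k. c * a k) = c *\<^sub>R read_mat m n a"
  by (rule fvec_eqI; clarsimp simp: coord_read_mat)+

lemma inner_read_mat: "inner (read_mat m n a) (read_mat m n b) = (\<Sum>k<m * n. a k * b k)"
proof -
  have "inner (read_mat m n a) (read_mat m n b) = (\<Sum>i<m. \<Sum>j<n. a (i * n + j) * b (i * n + j))"
    unfolding inner_mats[OF read_mat_in_mats] by (simp add: coord_read_mat)
  also have "\<dots> = (\<Sum>i<m. \<Sum>k\<in>{i * n..<i * n + n}. a k * b k)"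
    by (simp add: sum.atLeastLessThan_shift_0[of _ "_ * n"] atLeast0LessThan)
  also have "\<dots> = (\<Sum>k<m * n. a k * b k)" by (rule sum.nat_group)
  finally show ?thesis .
qed

lemma read_mat_usv_entry:
  "read_mat m n a = usv m s s n (read_mat m s (reals st ''u'')) (vec_of s (reals st ''p'')) (read_mat n s (reals st ''v''))"
  if "\<forall>i<m. \<forall>j<n. a (i * n + j) = usv_entry st s i j"
  by (rule mats_eqI[of _ m n])
    (use that in \<open>auto simp: coord_read_mat coord_usv usv_entry_def coord_vec_of intro!: sum.cong\<close>)

subsection \<open>The program\<close>

abbreviation elt :: "name \<Rightarrow> rexp" where
  "elt a \<equiv> RGet a (IVar ''k'')"

abbreviation scal :: "name \<Rightarrow> rexp" where
  "scal a \<equiv> RGet a (INum 0)"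

definition init_prog :: prog where
  "init_prog = Seq (fill ''y'' (elt ''x'')) (fill ''hy'' (elt ''hx''))"

text \<open>
  The cell hy holds the product of the Hessian with the current iterate.  It is updated along with
  the iterate, so the only product computed in an iteration is that with the candidate zp.
\<close>

definition norm_prog :: prog where
  "norm_prog = accumulate ''acc'' (RMul (RSub (elt ''y'') (elt ''x'')) (RSub (elt ''y'') (elt ''x'')))"

text \<open>The entrywise form of \<open>model_gradient_eq\<close>, with \<open>acc\<close> holding
  the squared distance of the iterate from the centre of the model. For c = 0 the last term
  vanishes, so one program serves both models.\<close>

definition grad_prog :: prog where
  "grad_prog = fill ''grad'' (RAdd (RAdd (elt ''g'') (RSub (elt ''hy'') (elt ''hx'')))
     (RMul (RMul (RDiv (scal ''cubic'') (RNum 2)) (RSqrt (scal ''acc''))) (RSub (elt ''y'') (elt ''x''))))"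

definition forward_prog :: prog where
  "forward_prog = fill ''z'' (RSub (elt ''y'')
     (RMul (RDiv (RNum 1) (RMul (scal ''lam'') (scal ''beta''))) (elt ''grad'')))"

text \<open>The finite part of \<psi> at the candidate. The indicator is 0 on M and \<psi> is 0 at
  the current iterate, so the sign of this number decides the selection.\<close>

definition psi_prog :: prog where
  "psi_prog = accumulate ''acc'' (RAdd (RMul (RSub (elt ''zp'') (elt ''y'')) (elt ''grad''))
     (RMul (RDiv (RMul (scal ''lam'') (scal ''beta'')) (RNum 2))
       (RMul (RSub (elt ''zp'') (elt ''y'')) (RSub (elt ''zp'') (elt ''y'')))))"

text \<open>Rejecting the candidate also overwrites \<open>hz\<close> by \<open>hy\<close>, so that
  \<open>hz\<close> is the Hessian product of the selected point in both branches.\<close>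

definition select_prog :: prog where
  "select_prog = IfLe (scal ''acc'') (RNum 0) (fill ''w'' (elt ''zp''))
     (Seq (fill ''w'' (elt ''y'')) (fill ''hz'' (elt ''hy'')))"

definition update_prog :: "name \<Rightarrow> name \<Rightarrow> prog" where
  "update_prog a b = fill a (RAdd (RMul (RSub (RNum 1) (scal ''lam'')) (elt a)) (RMul (scal ''lam'') (elt b)))"

definition body_prog :: prog where
  "body_prog = Seq norm_prog (Seq grad_prog (Seq forward_prog
     (Seq (SvdOracle ''z'' ''u'' ''sig'' ''v'') (Seq (ProjOracle ''sig'' ''p'') (Seq (HessOracle ''u'' ''p'' ''v'' ''hz'')
     (Seq usv_prog (Seq psi_prog (Seq select_prog (Seq (update_prog ''y'' ''w'') (update_prog ''hy'' ''hz''))))))))))"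

locale stored_dims =
  fixes m n s :: nat
  assumes s_pos: "1 \<le> s" and s_le: "s \<le> min m n"
begin

definition stored :: "machine \<Rightarrow> bool" where
  "stored st \<longleftrightarrow> ints st ''m'' = m \<and> ints st ''n'' = n \<and> ints st ''s'' = s"

abbreviation arr :: "machine \<Rightarrow> name \<Rightarrow> rmat" where
  "arr st a \<equiv> read_mat m n (reals st a)"

text \<open>All three dimensions are at least 1, so every lower-order cost, even a constant, is
  bounded by s m n.\<close>

lemma bounds: "m * n \<le> s * m * n" "m \<le> s * m * n" "1 \<le> s * m * n"
proof -
  have mn: "1 \<le> m" "1 \<le> n" using s_pos s_le by auto
  have "1 * (m * n) \<le> s * (m * n)" using s_pos by (rule mult_le_mono1)
  then show 1: "m * n \<le> s * m * n" by (simp add: mult.assoc)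
  have "m * 1 \<le> m * n" using mn(2) by (rule mult_le_mono2)
  with 1 show 2: "m \<le> s * m * n" by linarith
  with mn(1) show "1 \<le> s * m * n" by linarith
qed

lemma stored_changes:
  assumes "changes A X c st st'" "stored st" "X \<inter> {''m'', ''n'', ''s''} = {}"
  shows "stored st'"
  using assms by (auto simp: changes_def stored_def)

lemma fill_changes:
  assumes "stored st"
    and "\<And>k I A. k < m * n \<Longrightarrow> I ''k'' = k \<Longrightarrow> (\<And>b. b \<noteq> a \<Longrightarrow> A b = reals st b) \<Longrightarrow>
      A a k = reals st a k \<Longrightarrow> reval I A r = \<phi> k"
  shows "changes {a} {''k''} ((7 + rcost r) * (s * m * n)) st (exec E (fill a r) st)"
    and "arr (exec E (fill a r) st) a = read_mat m n \<phi>"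
    and "stored (exec E (fill a r) st)"
proof -
  have "ints st ''m'' = m" "ints st ''n'' = n" using assms(1) by (auto simp: stored_def)
  then have *: "changes {a} {''k''} ((7 + rcost r) * (s * m * n)) st (exec E (fill a r) st)"
    "\<forall>k<m * n. reals (exec E (fill a r) st) a k = \<phi> k"
    by (rule exec_fill[OF _ _ _ bounds(1,3)]; simp add: assms(2))+
  show "changes {a} {''k''} ((7 + rcost r) * (s * m * n)) st (exec E (fill a r) st)" by (rule *(1))
  show "arr (exec E (fill a r) st) a = read_mat m n \<phi>" using *(2) by (intro read_mat_cong) blast
  show "stored (exec E (fill a r) st)" by (rule stored_changes[OF *(1) assms(1)]) simp
qed

lemma accumulate_changes:
  assumes "stored st"
    and "\<And>k I A. k < m * n \<Longrightarrow> I ''k'' = k \<Longrightarrow> (\<And>b. b \<noteq> a \<Longrightarrow> A b = reals st b) \<Longrightarrow>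
      reval I A r = \<phi> k"
  shows "changes {a} {''k''} ((13 + rcost r) * (s * m * n)) st (exec E (accumulate a r) st)"
    and "reals (exec E (accumulate a r) st) a 0 = (\<Sum>k<m * n. \<phi> k)"
    and "stored (exec E (accumulate a r) st)"
proof -
  have "ints st ''m'' = m" "ints st ''n'' = n" using assms(1) by (auto simp: stored_def)
  then have *: "changes {a} {''k''} ((13 + rcost r) * (s * m * n)) st (exec E (accumulate a r) st)"
    "reals (exec E (accumulate a r) st) a 0 = (\<Sum>k<m * n. \<phi> k)"
    by (rule exec_accumulate[OF _ _ _ bounds(1,3)]; simp add: assms(2))+
  show "changes {a} {''k''} ((13 + rcost r) * (s * m * n)) st (exec E (accumulate a r) st)"
    "reals (exec E (accumulate a r) st) a 0 = (\<Sum>k<m * n. \<phi> k)" by (rule *)+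
  show "stored (exec E (accumulate a r) st)" by (rule stored_changes[OF *(1) assms(1)]) simp
qed

section \<open>Effect and cost of the blocks of the program\<close>

lemma init_changes:
  fixes E :: oracles
  assumes "stored st"
  defines "st' \<equiv> exec E init_prog st"
  shows "changes {''y'', ''hy''} {''k''} (18 * (s * m * n)) st st'" "stored st'"
    "arr st' ''y'' = arr st ''x''" "arr st' ''hy'' = arr st ''hx''"
proof -
  define st1 where "st1 = exec E (fill ''y'' (elt ''x'')) st"
  have st': "st' = exec E (fill ''hy'' (elt ''hx'')) st1" by (simp add: st'_def st1_def init_prog_def)
  have 1: "changes {''y''} {''k''} (9 * (s * m * n)) st st1" "arr st1 ''y'' = arr st ''x''" "stored st1"
    using fill_changes[OF assms(1), of "''y''" "elt ''x''" "reals st ''x''" E] by (auto simp: st1_def)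
  have 2: "changes {''hy''} {''k''} (9 * (s * m * n)) st1 st'" "arr st' ''hy'' = arr st1 ''hx''" "stored st'"
    using fill_changes[OF 1(3), of "''hy''" "elt ''hx''" "reals st1 ''hx''" E] by (auto simp: st')
  show "changes {''y'', ''hy''} {''k''} (18 * (s * m * n)) st st'"
    by (rule changes_trans[OF 1(1) 2(1)]) auto
  show "stored st'" "arr st' ''y'' = arr st ''x''" "arr st' ''hy'' = arr st ''hx''"
    using 1 2 by (auto simp: changes_def)
qed

lemma select_changes:
  fixes E :: oracles
  assumes "stored st"
  defines "st' \<equiv> exec E select_prog st"
  shows "changes {''w'', ''hz''} {''k''} (22 * (s * m * n)) st st'" "stored st'"
    "arr st' ''w'' = (if reals st ''acc'' 0 \<le> 0 then arr st ''zp'' else arr st ''y'')"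
    "arr st' ''hz'' = (if reals st ''acc'' 0 \<le> 0 then arr st ''hz'' else arr st ''hy'')"
proof -
  let ?st = "tick 4 st"
  have t: "changes {} {} (4 * (s * m * n)) st ?st" "stored ?st"
    using assms(1) bounds by (auto simp: changes_def tick_def stored_def)
  have "changes {''w'', ''hz''} {''k''} (22 * (s * m * n)) st st' \<and> stored st' \<and>
    arr st' ''w'' = (if reals st ''acc'' 0 \<le> 0 then arr st ''zp'' else arr st ''y'') \<and>
    arr st' ''hz'' = (if reals st ''acc'' 0 \<le> 0 then arr st ''hz'' else arr st ''hy'')"
  proof (cases "reals st ''acc'' 0 \<le> 0")
    case True
    then have st': "st' = exec E (fill ''w'' (elt ''zp'')) ?st"
      by (simp add: st'_def select_prog_def numeral_eq_Suc)
    have 1: "changes {''w''} {''k''} (9 * (s * m * n)) ?st st'" "arr st' ''w'' = arr ?st ''zp''" "stored st'"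
      using fill_changes[OF t(2), of "''w''" "elt ''zp''" "reals ?st ''zp''" E] by (auto simp: st')
    have "changes {''w'', ''hz''} {''k''} (22 * (s * m * n)) st st'"
      by (rule changes_trans[OF t(1) 1(1)]) auto
    then show ?thesis using 1 True by (auto simp: changes_def tick_def)
  next
    case False
    define st1 where "st1 = exec E (fill ''w'' (elt ''y'')) ?st"
    have st': "st' = exec E (fill ''hz'' (elt ''hy'')) st1"
      using False by (simp add: st'_def st1_def select_prog_def numeral_eq_Suc)
    have 1: "changes {''w''} {''k''} (9 * (s * m * n)) ?st st1" "arr st1 ''w'' = arr ?st ''y''" "stored st1"
      using fill_changes[OF t(2), of "''w''" "elt ''y''" "reals ?st ''y''" E] by (auto simp: st1_def)
    have 2: "changes {''hz''} {''k''} (9 * (s * m * n)) st1 st'" "arr st' ''hz'' = arr st1 ''hy''" "stored st'"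
      using fill_changes[OF 1(3), of "''hz''" "elt ''hy''" "reals st1 ''hy''" E] by (auto simp: st')
    have "changes {''w''} {''k''} (13 * (s * m * n)) st st1"
      by (rule changes_trans[OF t(1) 1(1)]) auto
    then have "changes {''w'', ''hz''} {''k''} (22 * (s * m * n)) st st'"
      by (rule changes_trans[OF _ 2(1)]) auto
    then show ?thesis using 1 2 False by (auto simp: changes_def tick_def)
  qed
  then show "changes {''w'', ''hz''} {''k''} (22 * (s * m * n)) st st'" "stored st'"
    "arr st' ''w'' = (if reals st ''acc'' 0 \<le> 0 then arr st ''zp'' else arr st ''y'')"
    "arr st' ''hz'' = (if reals st ''acc'' 0 \<le> 0 then arr st ''hz'' else arr st ''hy'')" by blast+
qed

lemma update_changes:
  fixes E :: oracles
  assumes "stored st" "a \<noteq> ''lam''" "a \<noteq> b"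
  defines "st' \<equiv> exec E (update_prog a b) st"
  shows "changes {a} {''k''} (20 * (s * m * n)) st st'" "stored st'"
    "arr st' a = (1 - reals st ''lam'' 0) *\<^sub>R arr st a + reals st ''lam'' 0 *\<^sub>R arr st b"
proof -
  let ?r = "RAdd (RMul (RSub (RNum 1) (scal ''lam'')) (elt a)) (RMul (scal ''lam'') (elt b))"
  let ?\<phi> = "\<lambda>k. (1 - reals st ''lam'' 0) * reals st a k + reals st ''lam'' 0 * reals st b k"
  have r: "reval I A ?r = ?\<phi> k"
    if "I ''k'' = k" "\<And>c. c \<noteq> a \<Longrightarrow> A c = reals st c" "A a k = reals st a k" for k I A
    using that(1,3) that(2)[of b] that(2)[of "''lam''"] assms(2,3) by simp
  have F: "changes {a} {''k''} ((7 + rcost ?r) * (s * m * n)) st st'"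
    "arr st' a = read_mat m n ?\<phi>" "stored st'"
    unfolding st'_def update_prog_def by (rule fill_changes[OF assms(1)]; rule r; simp)+
  show "changes {a} {''k''} (20 * (s * m * n)) st st'" using F(1) by simp
  show "stored st'" by (rule F(3))
  show "arr st' a = (1 - reals st ''lam'' 0) *\<^sub>R arr st a + reals st ''lam'' 0 *\<^sub>R arr st b"
    unfolding F(2) read_mat_add read_mat_scale ..
qed

lemma forward_changes:
  fixes E :: oracles
  assumes "stored st"
  defines "st1 \<equiv> exec E norm_prog st"
  defines "st2 \<equiv> exec E grad_prog st1"
  defines "st3 \<equiv> exec E forward_prog st2"
  defines "D \<equiv> arr st ''y'' - arr st ''x''"
  defines "G \<equiv> arr st ''g'' + (arr st ''hy'' - arr st ''hx'') + (reals st ''cubic'' 0 / 2 * norm D) *\<^sub>R D"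
  shows "changes {''acc'', ''grad'', ''z''} {''k''} (74 * (s * m * n)) st st3" "stored st3"
    "arr st3 ''grad'' = G"
    "arr st3 ''z'' = arr st ''y'' - (1 / (reals st ''lam'' 0 * reals st ''beta'' 0)) *\<^sub>R G"
proof -
  have 1: "changes {''acc''} {''k''} (24 * (s * m * n)) st st1" "stored st1"
    "reals st1 ''acc'' 0 = (\<Sum>k<m * n. (reals st ''y'' k - reals st ''x'' k) * (reals st ''y'' k - reals st ''x'' k))"
    using accumulate_changes[OF assms(1), of "''acc''" "RMul (RSub (elt ''y'') (elt ''x'')) (RSub (elt ''y'') (elt ''x''))"
        "\<lambda>k. (reals st ''y'' k - reals st ''x'' k) * (reals st ''y'' k - reals st ''x'' k)" E]
    by (auto simp: st1_def norm_prog_def)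
  have "reals st1 ''acc'' 0 = inner D D"
    unfolding 1(3) inner_read_mat[symmetric] by (simp add: D_def read_mat_diff)
  then have acc: "sqrt (reals st1 ''acc'' 0) = norm D" by (simp add: norm_eq_sqrt_inner)
  let ?r2 = "RAdd (RAdd (elt ''g'') (RSub (elt ''hy'') (elt ''hx'')))
     (RMul (RMul (RDiv (scal ''cubic'') (RNum 2)) (RSqrt (scal ''acc''))) (RSub (elt ''y'') (elt ''x'')))"
  let ?\<phi> = "\<lambda>k. reals st ''g'' k + (reals st ''hy'' k - reals st ''hx'' k)
      + reals st ''cubic'' 0 / 2 * norm D * (reals st ''y'' k - reals st ''x'' k)"
  have r: "reval I A ?r2 = ?\<phi> k" if "I ''k'' = k" "\<And>b. b \<noteq> ''grad'' \<Longrightarrow> A b = reals st1 b" for k I A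
    using that 1(1) acc by (simp add: changes_def)
  have F: "changes {''grad''} {''k''} ((7 + rcost ?r2) * (s * m * n)) st1 st2"
    "arr st2 ''grad'' = read_mat m n ?\<phi>" "stored st2"
    unfolding st2_def grad_prog_def by (rule fill_changes[OF 1(2)]; rule r; simp)+
  have 2: "changes {''grad''} {''k''} (30 * (s * m * n)) st1 st2" "stored st2" "arr st2 ''grad'' = G"
  proof -
    show "changes {''grad''} {''k''} (30 * (s * m * n)) st1 st2" using F(1) by simp
    show "stored st2" by (rule F(3))
    show "arr st2 ''grad'' = G"
      unfolding F(2) G_def D_def read_mat_add read_mat_diff read_mat_scale ..
  qed
  let ?r3 = "RSub (elt ''y'') (RMul (RDiv (RNum 1) (RMul (scal ''lam'') (scal ''beta''))) (elt ''grad''))"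
  let ?\<phi> = "\<lambda>k. reals st2 ''y'' k - 1 / (reals st2 ''lam'' 0 * reals st2 ''beta'' 0) * reals st2 ''grad'' k"
  have r: "reval I A ?r3 = ?\<phi> k" if "I ''k'' = k" "\<And>b. b \<noteq> ''z'' \<Longrightarrow> A b = reals st2 b" for k I A
    using that by simp
  have F: "changes {''z''} {''k''} ((7 + rcost ?r3) * (s * m * n)) st2 st3"
    "arr st3 ''z'' = read_mat m n ?\<phi>" "stored st3"
    unfolding st3_def forward_prog_def by (rule fill_changes[OF 2(2)]; rule r; simp)+
  have 3: "changes {''z''} {''k''} (20 * (s * m * n)) st2 st3" "stored st3"
      "arr st3 ''z'' = arr st2 ''y'' - (1 / (reals st2 ''lam'' 0 * reals st2 ''beta'' 0)) *\<^sub>R arr st2 ''grad''"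
  proof -
    show "changes {''z''} {''k''} (20 * (s * m * n)) st2 st3" using F(1) by simp
    show "stored st3" by (rule F(3))
    show "arr st3 ''z'' = arr st2 ''y'' - (1 / (reals st2 ''lam'' 0 * reals st2 ''beta'' 0)) *\<^sub>R arr st2 ''grad''"
      unfolding F(2) read_mat_diff read_mat_scale ..
  qed
  have 12: "changes {''acc'', ''grad''} {''k''} (54 * (s * m * n)) st st2"
    by (rule changes_trans[OF 1(1) 2(1)]) auto
  show "changes {''acc'', ''grad'', ''z''} {''k''} (74 * (s * m * n)) st st3"
    by (rule changes_trans[OF 12 3(1)]) auto
  show "stored st3" by (rule 3(2))
  show "arr st3 ''grad'' = G" using 3(1) 2(3) by (simp add: changes_def)
  show "arr st3 ''z'' = arr st ''y'' - (1 / (reals st ''lam'' 0 * reals st ''beta'' 0)) *\<^sub>R G"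
    using 3(3) 12 2(3) by (simp add: changes_def)
qed

lemma psi_changes:
  fixes E :: oracles
  assumes "stored st"
  defines "st' \<equiv> exec E psi_prog st"
  defines "D \<equiv> arr st ''zp'' - arr st ''y''"
  shows "changes {''acc''} {''k''} (41 * (s * m * n)) st st'" "stored st'"
    "reals st' ''acc'' 0 = inner D (arr st ''grad'') + reals st ''lam'' 0 * reals st ''beta'' 0 / 2 * (norm D)\<^sup>2"
proof -
  let ?a = "reals st"
  let ?r = "RAdd (RMul (RSub (elt ''zp'') (elt ''y'')) (elt ''grad''))
     (RMul (RDiv (RMul (scal ''lam'') (scal ''beta'')) (RNum 2))
       (RMul (RSub (elt ''zp'') (elt ''y'')) (RSub (elt ''zp'') (elt ''y''))))"
  let ?\<phi> = "\<lambda>k. (?a ''zp'' k - ?a ''y'' k) * ?a ''grad'' k +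
      ?a ''lam'' 0 * ?a ''beta'' 0 / 2 * ((?a ''zp'' k - ?a ''y'' k) * (?a ''zp'' k - ?a ''y'' k))"
  have r: "reval I A ?r = ?\<phi> k" if "I ''k'' = k" "\<And>b. b \<noteq> ''acc'' \<Longrightarrow> A b = reals st b" for k I A
    using that by simp
  have F: "changes {''acc''} {''k''} ((13 + rcost ?r) * (s * m * n)) st st'"
    "reals st' ''acc'' 0 = (\<Sum>k<m * n. ?\<phi> k)" "stored st'"
    unfolding st'_def psi_prog_def by (rule accumulate_changes[OF assms(1)]; rule r; simp)+
  show "changes {''acc''} {''k''} (41 * (s * m * n)) st st'" using F(1) by simp
  show "stored st'" by (rule F(3))
  show "reals st' ''acc'' 0 = inner D (arr st ''grad'') + ?a ''lam'' 0 * ?a ''beta'' 0 / 2 * (norm D)\<^sup>2"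
    unfolding F(2) sum.distrib sum_distrib_left[symmetric] inner_read_mat[symmetric]
    by (simp add: D_def read_mat_diff power2_norm_eq_inner)
qed

text \<open>A statement about memory and cost alone: the oracles enter through the shapes of their
  answers, and the spectral meaning of these answers is supplied in
  \<open>body_correct\<close>.\<close>

lemma body_changes:
  fixes E :: oracles
  assumes "stored st" and dims: "dim_m E = m" "dim_n E = n" "dim_s E = s"
    and count: "svd_calls st = 0" "proj_calls st = 0" "hess_calls st = 0" "steps st = 0"
  defines "D \<equiv> arr st ''y'' - arr st ''x''"
  defines "G \<equiv> arr st ''g'' + (arr st ''hy'' - arr st ''hx'') + (reals st ''cubic'' 0 / 2 * norm D) *\<^sub>R D"
  defines "lb \<equiv> reals st ''lam'' 0 * reals st ''beta'' 0"
  assumes svd: "svd_fun E (arr st ''y'' - (1 / lb) *\<^sub>R G) = (U, \<sigma>, V)"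
    and mem: "U \<in> mats m s" "\<sigma> \<in> vecs s" "V \<in> mats n s" "proj_fun E \<sigma> \<in> vecs s"
      "hess_fun E U (proj_fun E \<sigma>) V \<in> mats m n"
  defines "z' \<equiv> usv m s s n U (proj_fun E \<sigma>) V"
  defines "accept \<equiv> inner (z' - arr st ''y'') G + lb / 2 * (norm (z' - arr st ''y''))\<^sup>2 \<le> 0"
  defines "st' \<equiv> exec E body_prog st"
  shows "stored st'" "\<And>a. a \<in> {''x'', ''g'', ''hx'', ''beta'', ''cubic''} \<Longrightarrow> reals st' a = reals st a"
    "arr st' ''w'' = (if accept then z' else arr st ''y'')"
    "arr st' ''y'' = (1 - reals st ''lam'' 0) *\<^sub>R arr st ''y'' + reals st ''lam'' 0 *\<^sub>R arr st' ''w''"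
    "arr st' ''hy'' = (1 - reals st ''lam'' 0) *\<^sub>R arr st ''hy'' + reals st ''lam'' 0 *\<^sub>R
       (if accept then hess_fun E U (proj_fun E \<sigma>) V else arr st ''hy'')"
    "svd_calls st' = 1" "proj_calls st' = 1" "hess_calls st' = 1" "steps st' \<le> 226 * (s * m * n)"
proof -
  let ?W = "s * m * n" and ?p = "proj_fun E \<sigma>"
  define st3 where "st3 = exec E forward_prog (exec E grad_prog (exec E norm_prog st))"
  note 3 = forward_changes[OF assms(1), where E = E, folded st3_def, folded D_def, folded G_def, folded lb_def]
  define st4 where "st4 = exec E (HessOracle ''u'' ''p'' ''v'' ''hz'')
    (exec E (ProjOracle ''sig'' ''p'') (exec E (SvdOracle ''z'' ''u'' ''sig'' ''v'') st3))"
  \<comment> \<open>Arrays of the right shape are read back unchanged, so the projection and the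
    Hessian product receive exactly the data returned by the preceding calls.\<close>
  have st4: "st4 = st3\<lparr>reals := (reals st3)(''u'' := write_mat m s U, ''sig'' := write_vec s \<sigma>, ''v'' := write_mat n s V,
        ''p'' := write_vec s ?p, ''hz'' := write_mat m n (hess_fun E U ?p V)),
      steps := steps st3 + 3, svd_calls := Suc (svd_calls st3), proj_calls := Suc (proj_calls st3),
      hess_calls := Suc (hess_calls st3)\<rparr>"
    using 3(4) svd mem
    by (simp add: st4_def dims tick_def vec_of_write_vec read_write_mat fun_upd_twist)
  have stored4: "stored st4" using 3(2) by (simp add: st4 stored_def)
  define st5 where "st5 = exec E usv_prog st4"
  have 5: "changes {''zp''} {''i'', ''j'', ''l''} (46 * ?W) st4 st5"
    "\<forall>i<m. \<forall>j<n. reals st5 ''zp'' (i * n + j) = usv_entry st4 s i j"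
    using exec_usv_prog[of st4 m n s ?W E] stored4 bounds unfolding st5_def stored_def by simp_all
  have stored5: "stored st5" by (rule stored_changes[OF 5(1) stored4]) simp
  have zp: "arr st5 ''zp'' = z'"
    using read_mat_usv_entry[OF 5(2)] mem by (simp add: st4 z'_def read_write_mat vec_of_write_vec)
  define st6 where "st6 = exec E psi_prog st5"
  note 6 = psi_changes[OF stored5, where E = E, folded st6_def]
  have st5: "arr st5 ''grad'' = G" "arr st5 ''y'' = arr st ''y''" "arr st5 ''hy'' = arr st ''hy''"
      "reals st5 ''lam'' = reals st ''lam''" "reals st5 ''beta'' = reals st ''beta''"
      "arr st5 ''hz'' = hess_fun E U ?p V"
    using 5(1) 3(1,3) mem(5) by (simp_all add: changes_def st4 read_write_mat)
  have accept: "accept \<longleftrightarrow> reals st6 ''acc'' 0 \<le> 0"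
    unfolding accept_def 6(3) zp st5 lb_def ..
  define st7 where "st7 = exec E select_prog st6"
  note 7 = select_changes[OF 6(2), where E = E, folded st7_def, folded accept]
  define st8 where "st8 = exec E (update_prog ''y'' ''w'') st7"
  have 8: "changes {''y''} {''k''} (20 * ?W) st7 st8" "stored st8"
    "arr st8 ''y'' = (1 - reals st7 ''lam'' 0) *\<^sub>R arr st7 ''y'' + reals st7 ''lam'' 0 *\<^sub>R arr st7 ''w''"
    using update_changes[OF 7(2), of "''y''" "''w''" E] by (simp_all add: st8_def)
  have st': "st' = exec E (update_prog ''hy'' ''hz'') st8"
    by (simp add: st'_def body_prog_def st8_def st7_def st6_def st5_def st4_def st3_def)
  have 9: "changes {''hy''} {''k''} (20 * ?W) st8 st'" "stored st'"
    "arr st' ''hy'' = (1 - reals st8 ''lam'' 0) *\<^sub>R arr st8 ''hy'' + reals st8 ''lam'' 0 *\<^sub>R arr st8 ''hz''"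
    using update_changes[OF 8(2), of "''hy''" "''hz''" E] by (simp_all add: st')
  show "stored st'" by (rule 9(2))
  show "reals st' a = reals st a" if "a \<in> {''x'', ''g'', ''hx'', ''beta'', ''cubic''}" for a
    using that 3(1) 5(1) 6(1) 7(1) 8(1) 9(1) by (elim insertE emptyE) (simp_all add: changes_def st4)
  have w: "arr st7 ''w'' = (if accept then z' else arr st ''y'')"
    using 6(1) 7(3) zp st5 by (simp add: changes_def)
  show "arr st' ''w'' = (if accept then z' else arr st ''y'')"
    using w 8(1) 9(1) by (simp add: changes_def)
  show "arr st' ''y'' = (1 - reals st ''lam'' 0) *\<^sub>R arr st ''y'' + reals st ''lam'' 0 *\<^sub>R arr st' ''w''"
    using 6(1) 7(1) 8(1,3) 9(1) st5 by (simp add: changes_def)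
  show "arr st' ''hy'' = (1 - reals st ''lam'' 0) *\<^sub>R arr st ''hy'' + reals st ''lam'' 0 *\<^sub>R
       (if accept then hess_fun E U ?p V else arr st ''hy'')"
    using 6(1) 7(1,4) 8(1) 9(1,3) st5 by (simp add: changes_def)
  show "svd_calls st' = 1" "proj_calls st' = 1" "hess_calls st' = 1"
    using count 3(1) 5(1) 6(1) 7(1) 8(1) 9(1) by (auto simp: changes_def st4)
  have steps: "steps t' \<le> steps t + c" if "changes A X c t t'" for A X c t t'
    using that by (simp add: changes_def)
  \<comment> \<open>The blocks contribute 74 + 46 + 41 + 22 + 20 + 20 = 223 multiples of s m n; the
    three oracle steps account for the remaining 3.\<close>
  have "steps st4 = steps st3 + 3" by (simp add: st4)
  with steps[OF 3(1)] steps[OF 5(1)] steps[OF 6(1)] steps[OF 7(1)] steps[OF 8(1)] steps[OF 9(1)] count(4)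
  show "steps st' \<le> 226 * ?W" using bounds(3) by linarith
qed

end

subsection \<open>Correctness of an iteration\<close>

lemma proximal_square:
  fixes u y g :: "'a::real_inner"
  assumes "l \<noteq> 0"
  shows "inner (u - y) g + l / 2 * (norm (u - y))\<^sup>2 =
    l / 2 * (norm (u - (y - (1 / l) *\<^sub>R g)))\<^sup>2 - inner g g / (2 * l)"
proof -
  have "u - (y - (1 / l) *\<^sub>R g) = (u - y) + (1 / l) *\<^sub>R g" by simp
  then have "(norm (u - (y - (1 / l) *\<^sub>R g)))\<^sup>2 =
      (norm (u - y))\<^sup>2 + 2 / l * inner (u - y) g + inner g g / l\<^sup>2"
    by (simp only: power2_norm_eq_inner inner_add_left inner_add_right inner_scaleR_left inner_scaleR_right)
      (use assms in \<open>simp add: inner_commute power2_eq_square field_simps\<close>)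
  then show ?thesis using assms by (simp add: field_simps power2_eq_square)
qed

text \<open>The coefficient \<open>c\<close> is left arbitrary, which treats the quadratic and the
  cubically regularized model together.\<close>

locale low_rank_wpo = stored_dims m n s for m n s +
  fixes K :: "rvec set" and M :: "rmat set" and R :: "rmat \<Rightarrow> ereal" and f :: "rmat \<Rightarrow> real"
    and gradf :: "rmat \<Rightarrow> rmat" and hessf :: "rmat \<Rightarrow> rmat \<Rightarrow>\<^sub>L rmat" and xstar xt :: rmat
    and \<beta>t c :: real and E :: oracles
  assumes K: "K \<subseteq> vecs (min m n)" "\<forall>\<sigma>\<in>K. \<forall>i. 0 \<le> coord \<sigma> i" "compact K" "perm_closed (min m n) K"
    and M: "M = spectral_set m n K" "convex M"
    and R: "R = indicator_fun M"
    and f: "twice_differentiable m n M f gradf hessf"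
    and xstar: "xstar \<in> M" "mat_rank m n xstar \<le> s"
    and xt: "xt \<in> M" and \<beta>t: "0 < \<beta>t"
    and dims: "dim_m E = m" "dim_n E = n" "dim_s E = s"
    and svd: "svd_oracle m n s (svd_fun E)"
    and proj: "proj_oracle m n s K (proj_fun E)"
    and hess: "hess_oracle m n s (hessf xt) (hess_fun E)"
begin

abbreviation model_gradient :: "rmat \<Rightarrow> rmat" where
  "model_gradient \<equiv> gradient_on (mats m n) (model gradf hessf xt c)"

lemma M_subset: "M \<subseteq> mats m n"
  unfolding M(1) spectral_set_def by auto

lemma edom_R: "edom R = M"
  by (auto simp: edom_def R indicator_fun_def)

lemma derivatives_in_mats: "gradf xt \<in> mats m n" "blinfun_apply (hessf xt) h \<in> mats m n"
  using f xt unfolding twice_differentiable_def by blast+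

text \<open>Linearity splits the Hessian term into the stored product with the iterate minus the
  given product with xt, so forming the gradient requires no new Hessian product.\<close>

lemma model_gradient_eq: "y \<in> M \<Longrightarrow> model_gradient y =
    gradf xt + (hessf xt y - hessf xt xt) + (c / 2 * norm (y - xt)) *\<^sub>R (y - xt)"
  using gradient_on_model[OF M f xt, of y c] by (simp add: blinfun.diff_right)

text \<open>Membership of the iterate in M validates the gradient formula and keeps \<psi> finite at
  that point.\<close>

definition invariant :: "machine \<Rightarrow> bool" where
  "invariant st \<longleftrightarrow> stored st \<and> arr st ''x'' = xt \<and> arr st ''g'' = gradf xt \<and>
     arr st ''hx'' = hessf xt xt \<and> reals st ''beta'' 0 = \<beta>t \<and> reals st ''cubic'' 0 = c \<and>
     arr st ''y'' \<in> M \<and> arr st ''hy'' = hessf xt (arr st ''y'')"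

lemma init_correct:
  defines "st \<equiv> exec E init_prog (input_state m n s xt (gradf xt) (hessf xt xt) \<beta>t c)"
  shows "invariant st" "arr st ''y'' = xt" "svd_calls st = 0" "proj_calls st = 0" "hess_calls st = 0"
    "steps st \<le> 226 * (s * m * n)"
proof -
  let ?st = "input_state m n s xt (gradf xt) (hessf xt xt) \<beta>t c"
  have "stored ?st" by (simp add: stored_def input_state_def)
  note 1 = init_changes[OF this, of E, folded st_def]
  have 0: "arr ?st ''x'' = xt" "arr ?st ''g'' = gradf xt" "arr ?st ''hx'' = hessf xt xt"
    "reals ?st ''beta'' 0 = \<beta>t" "reals ?st ''cubic'' 0 = c"
    using xt M_subset derivatives_in_mats by (auto simp: input_state_def read_write_mat write_num_def)
  have eq: "reals st a = reals ?st a" if "a \<noteq> ''y''" "a \<noteq> ''hy''" for a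
    using 1(1) that by (simp add: changes_def)
  show y: "arr st ''y'' = xt" using 1(3) 0 by simp
  show "invariant st"
    unfolding invariant_def using 1(2,4) 0 y xt by (simp add: eq)
  have cost: "steps st \<le> steps ?st + 18 * (s * m * n)" "svd_calls st = svd_calls ?st"
      "proj_calls st = proj_calls ?st" "hess_calls st = hess_calls ?st"
    using 1(1) by (simp_all add: changes_def)
  then show "svd_calls st = 0" "proj_calls st = 0" "hess_calls st = 0"
    by (simp_all add: input_state_def)
  \<comment> \<open>Initialization takes at most 18 s m n steps; the larger bound lets one constant
    serve both programs.\<close>
  show "steps st \<le> 226 * (s * m * n)" using cost(1) by (simp add: input_state_def)
qed

lemma body_correct:
  assumes inv: "invariant st" and l: "0 \<le> l" "l \<le> 1"
  defines "y \<equiv> arr st ''y''"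
  defines "st' \<equiv> exec E body_prog (start_iteration l st)"
  defines "w \<equiv> arr st' ''w''"
  shows "invariant st'" "arr st' ''y'' = (1 - l) *\<^sub>R y + l *\<^sub>R w"
    "0 < l \<Longrightarrow> low_rank_step m n s K model_gradient \<beta>t R y l w"
    "0 < l \<Longrightarrow> wpo_output model_gradient \<beta>t R xstar y l w"
    "svd_calls st' = 1" "proj_calls st' = 1" "hess_calls st' = 1" "steps st' \<le> 226 * (s * m * n)"
proof -
  let ?st = "start_iteration l st" and ?H = "blinfun_apply (hessf xt)" and ?d = "min m n"
  have st: "stored ?st" "arr ?st ''x'' = xt" "arr ?st ''g'' = gradf xt" "arr ?st ''hx'' = ?H xt"
      "reals ?st ''beta'' 0 = \<beta>t" "reals ?st ''cubic'' 0 = c" "reals ?st ''lam'' 0 = l"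
      "arr ?st ''y'' = y" "arr ?st ''hy'' = ?H y" and yM: "y \<in> M"
    using inv by (simp_all add: invariant_def start_iteration_def stored_def write_num_def y_def)
  have count: "svd_calls ?st = 0" "proj_calls ?st = 0" "hess_calls ?st = 0" "steps ?st = 0"
    by (simp_all add: start_iteration_def)
  define G where "G = model_gradient y"
  have G: "arr ?st ''g'' + (arr ?st ''hy'' - arr ?st ''hx'')
      + (reals ?st ''cubic'' 0 / 2 * norm (arr ?st ''y'' - arr ?st ''x'')) *\<^sub>R (arr ?st ''y'' - arr ?st ''x'') = G"
    unfolding st G_def model_gradient_eq[OF yM] ..
  have "G \<in> mats m n"
    unfolding G_def model_gradient_eq[OF yM] using yM xt M_subset derivatives_in_mats
    by (intro subspace_add subspace_scale subspace_diff subspace_mats) auto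
  define z where "z = y - (1 / (l * \<beta>t)) *\<^sub>R G"
  have "z \<in> mats m n"
    unfolding z_def using yM M_subset \<open>G \<in> mats m n\<close>
    by (intro subspace_scale subspace_diff subspace_mats) auto
  then obtain U \<sigma> V where usv: "is_svd m n z U \<sigma> V" "top_entries s ?d \<sigma> {..<s}"
    and svd_z: "svd_fun E z = (mat_of m s (\<lambda>i k. coord U (i, k)), vec_of s (coord \<sigma>), mat_of n s (\<lambda>i k. coord V (i, k)))"
    using svd unfolding svd_oracle_def by blast
  have orth: "orth_cols m m U" "orth_cols n n V" using usv(1) by (auto simp: is_svd_def)
  let ?U = "mat_of m s (\<lambda>i k. coord U (i, k))" and ?V = "mat_of n s (\<lambda>i k. coord V (i, k))"
  define p where "p = proj_fun E (vec_of s (coord \<sigma>))"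
  have p: "p = projection (restrict_set ?d K {..<s}) (vec_of s (coord \<sigma>))"
    using proj by (simp add: p_def proj_oracle_def)
  then have p': "p = projection (K \<inter> vecs s) (vec_of s (coord \<sigma>))"
    by (simp add: restrict_set_lessThan(1)[OF s_le])
  note closest = truncated_projection_closest[OF s_le K(1,2,4,3) usv xstar[unfolded M(1)], folded p']
  have pK: "p \<in> K" "p \<in> vecs s" using closest(1) by auto
  define z' where "z' = usv m s s n ?U p ?V"
  have z': "z' = usv m m n n U p V"
    unfolding z'_def by (rule usv_truncate[OF pK(2) s_le])
  have z'M: "z' \<in> M" unfolding z' M(1) spectral_set_def using orth pK by blast
  \<comment> \<open>The Hessian oracle answers for orthonormal thin factors and nonnegative singular
    values; p is nonnegative as an element of K.\<close>
  have hess_z': "hess_fun E ?U p ?V = ?H z'"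
    using hess orth_cols_truncate[OF orth(1), of s] orth_cols_truncate[OF orth(2), of s] s_le pK K(2)
    unfolding hess_oracle_def z'_def by auto
  define q where "q u = inner (u - y) G + l * \<beta>t / 2 * (norm (u - y))\<^sup>2" for u
  have psi: "psi model_gradient \<beta>t R y l u = ereal (q u)" if "u \<in> M" for u
    using that by (simp add: psi_def R indicator_fun_def q_def G_def)
  have "svd_fun E (arr ?st ''y'' - (1 / (reals ?st ''lam'' 0 * reals ?st ''beta'' 0)) *\<^sub>R
      (arr ?st ''g'' + (arr ?st ''hy'' - arr ?st ''hx'')
      + (reals ?st ''cubic'' 0 / 2 * norm (arr ?st ''y'' - arr ?st ''x'')) *\<^sub>R (arr ?st ''y'' - arr ?st ''x'')))
    = (?U, vec_of s (coord \<sigma>), ?V)"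
    unfolding G unfolding st z_def[symmetric] by (rule svd_z)
  note body = body_changes[OF st(1) dims count this, folded p_def, folded st'_def,
    OF mat_of_in_mats vec_of_in_vecs mat_of_in_mats pK(2), unfolded hess_z' G, folded z'_def,
    OF derivatives_in_mats(2), unfolded st, folded w_def q_def]
  have w: "w = (if q z' \<le> 0 then z' else y)" by (rule body(3))
  have wM: "w \<in> M" using w yM z'M by simp
  show y': "arr st' ''y'' = (1 - l) *\<^sub>R y + l *\<^sub>R w" by (rule body(4))
  \<comment> \<open>\<open>hz\<close> belongs to the selected w in either branch, so by linearity
    the convex combination of products is the product with the new iterate.\<close>
  have "arr st' ''hy'' = (1 - l) *\<^sub>R ?H y + l *\<^sub>R ?H w"
    using body(5) w by simp
  then have hy': "arr st' ''hy'' = ?H (arr st' ''y'')"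
    by (simp add: y' blinfun.add_right blinfun.scaleR_right)
  have "arr st' ''y'' \<in> M"
    unfolding y' using l yM wM M(2) by (intro convexD) auto
  then show "invariant st'"
    using body(1,2) hy' st by (simp add: invariant_def)
  show "svd_calls st' = 1" "proj_calls st' = 1" "hess_calls st' = 1" "steps st' \<le> 226 * (s * m * n)"
    by (rule body)+
  \<comment> \<open>Hence accepting z' exactly when q z' \<le> 0 selects a minimizer of q among y
    and z'.\<close>
  have "q y = 0" by (simp add: q_def)
  then have argmin: "q w \<le> q z'" "q w \<le> q y" using w by auto
  show "low_rank_step m n s K model_gradient \<beta>t R y l w"
    unfolding low_rank_step_def
  proof (intro exI conjI)
    show "is_svd m n (y - (1 / (l * \<beta>t)) *\<^sub>R model_gradient y) U \<sigma> V"
      using usv(1) by (simp add: z_def G_def)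
    \<comment> \<open>The oracle lists the leading components first, so the index set T of the step
      is {..<s}.\<close>
    show "top_entries s ?d \<sigma> {..<s}" by (rule usv(2))
    show "z' = usv m m n n U (mvec ?d s (sel_mat ?d {..<s})
        (projection (restrict_set ?d K {..<s}) (restrict_to {..<s} \<sigma>))) V"
      using z' p pK(2) by (simp add: restrict_set_lessThan[OF s_le])
    show "is_arg_min (psi model_gradient \<beta>t R y l) (\<lambda>u. u \<in> {y, z'}) w"
      using argmin w yM z'M wM by (auto simp: is_arg_min_def psi not_less)
  qed
  show "wpo_output model_gradient \<beta>t R xstar y l w" if "0 < l"
  proof -
    \<comment> \<open>Positivity serves twice: it permits completing the square, and it preserves
      the order when squared distances are scaled.\<close>
    have lb: "0 < l * \<beta>t" using that \<beta>t by simp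
    have sq: "q u = l * \<beta>t / 2 * (norm (u - z))\<^sup>2 - inner G G / (2 * (l * \<beta>t))" for u
      unfolding q_def z_def using that \<beta>t by (intro proximal_square) simp
    have "(norm (z' - z))\<^sup>2 \<le> (norm (xstar - z))\<^sup>2"
      using closest(2) unfolding z' by (intro power_mono) auto
    then have "q z' \<le> q xstar"
      unfolding sq using lb by (intro diff_right_mono mult_left_mono) auto
    then show ?thesis
      unfolding wpo_output_def edom_R using argmin wM yM xstar(1) by (simp add: psi)
  qed
qed

end

text \<open>\<open>init_prog\<close>, \<open>body_prog\<close> and 226 are the witnesses, chosen
  before the dimensions and all data. An induction over the iterations maintains the invariant,
  which feeds \<open>body_correct\<close> at every step.\<close>

theorem corollary2:
  "\<exists>(init :: prog) (body :: prog) (C :: nat).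
    \<forall>(m :: nat) (n :: nat) (s :: nat) (K :: rvec set) (M :: rmat set) (R :: rmat \<Rightarrow> ereal)
     (f :: rmat \<Rightarrow> real) (gradf :: rmat \<Rightarrow> rmat) (hessf :: rmat \<Rightarrow> rmat \<Rightarrow>\<^sub>L rmat)
     (F :: rmat \<Rightarrow> ereal) (\<beta>\<^sub>2 :: real) (\<alpha> :: real) (\<beta> :: real) (\<beta>t :: real) (c :: real)
     (xstar :: rmat) (x1 :: rmat) (xt :: rmat) (gradQ :: rmat \<Rightarrow> rmat)
     (E :: oracles) (lam :: nat \<Rightarrow> real) (S :: nat \<Rightarrow> machine) (y :: nat \<Rightarrow> rmat) (w :: nat \<Rightarrow> rmat).
      1 \<le> s \<and> s \<le> min m n \<and>
      K \<subseteq> vecs (min m n) \<and> (\<forall>\<sigma>\<in>K. \<forall>i. 0 \<le> coord \<sigma> i) \<and>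
      convex K \<and> compact K \<and> perm_closed (min m n) K \<and>
      M = spectral_set m n K \<and> closed M \<and> convex M \<and>
      R = indicator_fun M \<and> F = objective f R \<and>
      convex_on (edom R) f \<and> twice_differentiable m n (edom R) f gradf hessf \<and>
      \<beta>\<^sub>2-lipschitz_on (edom R) hessf \<and>
      unique_minimizer m n F xstar \<and> mat_rank m n xstar \<le> s \<and>
      x1 \<in> edom R \<and> xt \<in> edom R \<and> F xt \<le> F x1 \<and>
      (assumption_A m n F hessf x1 \<alpha> \<beta> \<and> \<beta>t = \<beta> \<and> c = 0 \<or>
       assumption_B F (edom R) gradf xstar \<alpha> \<beta> \<and> \<beta>t = \<beta> + \<beta>\<^sub>2 * diameter (edom R) / 2 \<and> c = \<beta>\<^sub>2) \<and>
      0 < \<beta>t \<and>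
      gradQ = gradient_on (mats m n) (model gradf hessf xt c) \<and>
      dim_m E = m \<and> dim_n E = n \<and> dim_s E = s \<and>
      svd_oracle m n s (svd_fun E) \<and> proj_oracle m n s K (proj_fun E) \<and>
      hess_oracle m n s (hessf xt) (hess_fun E) \<and>
      (\<forall>i. 0 \<le> lam i \<and> lam i \<le> 1) \<and>
      S = run E init body lam
            (input_state m n s xt (gradf xt) (blinfun_apply (hessf xt) xt) \<beta>t c) \<and>
      (\<forall>i. y i = read_mat m n (reals (S i) ''y'')) \<and>
      (\<forall>i. w i = read_mat m n (reals (S (Suc i)) ''w''))
      \<longrightarrow>
      y 0 = xt \<and>
      svd_calls (S 0) = 0 \<and> proj_calls (S 0) = 0 \<and> hess_calls (S 0) = 0 \<and>
      steps (S 0) \<le> C * (s * m * n) \<and>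
      (\<forall>i.
        y i \<in> edom R \<and>
        (0 < lam i \<longrightarrow>
           low_rank_step m n s K gradQ \<beta>t R (y i) (lam i) (w i) \<and>
           wpo_output gradQ \<beta>t R xstar (y i) (lam i) (w i)) \<and>
        y (Suc i) = (1 - lam i) *\<^sub>R y i + lam i *\<^sub>R w i \<and>
        svd_calls (S (Suc i)) = 1 \<and>
        proj_calls (S (Suc i)) = 1 \<and>
        hess_calls (S (Suc i)) = 1 \<and>
        steps (S (Suc i)) \<le> C * (s * m * n))"
proof (intro exI allI impI, elim conjE)
  fix m n s K M R f gradf and hessf :: "rmat \<Rightarrow> rmat \<Rightarrow>\<^sub>L rmat" and F \<beta>\<^sub>2 \<alpha> \<beta> \<beta>t c xstar x1 xt gradQ E
    and lam :: "nat \<Rightarrow> real" and S y w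
  assume s: "1 \<le> s" "s \<le> min m n"
    and K: "K \<subseteq> vecs (min m n)" "\<forall>\<sigma>\<in>K. \<forall>i. 0 \<le> coord \<sigma> i" "compact K" "perm_closed (min m n) K"
    and M: "M = spectral_set m n K" "convex M"
    and R: "R = indicator_fun M" and F: "F = objective f R"
    and f: "twice_differentiable m n (edom R) f gradf hessf"
    and xstar: "unique_minimizer m n F xstar" "mat_rank m n xstar \<le> s"
    and xt: "xt \<in> edom R" and \<beta>t: "0 < \<beta>t"
    and gradQ: "gradQ = gradient_on (mats m n) (model gradf hessf xt c)"
    and dims: "dim_m E = m" "dim_n E = n" "dim_s E = s"
    and oracles: "svd_oracle m n s (svd_fun E)" "proj_oracle m n s K (proj_fun E)"
      "hess_oracle m n s (hessf xt) (hess_fun E)"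
    and lam: "\<forall>i. 0 \<le> lam i \<and> lam i \<le> 1"
    and S: "S = run E init_prog body_prog lam (input_state m n s xt (gradf xt) (hessf xt xt) \<beta>t c)"
    and y: "\<forall>i. y i = read_mat m n (reals (S i) ''y'')"
    and w: "\<forall>i. w i = read_mat m n (reals (S (Suc i)) ''w'')"
  have edom: "edom R = M" by (auto simp: edom_def R indicator_fun_def)
  \<comment> \<open>A minimizer has finite objective value, whereas the objective is \<infinity>
    outside M.\<close>
  have "xstar \<in> M"
    using xstar(1) by (auto simp: unique_minimizer_def F objective_def R indicator_fun_def split: if_splits)
  then interpret low_rank_wpo m n s K M R f gradf hessf xstar xt \<beta>t c E
    using s K M R f xstar(2) xt \<beta>t dims oracles unfolding edom by unfold_locales
  have S0: "S 0 = exec E init_prog (input_state m n s xt (gradf xt) (hessf xt xt) \<beta>t c)"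
    and SSuc: "S (Suc i) = exec E body_prog (start_iteration (lam i) (S i))" for i
    by (simp_all add: S)
  note init = init_correct[folded S0]
  have inv: "invariant (S i)" for i
  proof (induction i)
    case (Suc i)
    then show ?case using body_correct(1)[of "S i" "lam i"] lam unfolding SSuc by blast
  qed (rule init(1))
  have step: "y i \<in> edom R \<and>
      (0 < lam i \<longrightarrow> low_rank_step m n s K gradQ \<beta>t R (y i) (lam i) (w i) \<and>
         wpo_output gradQ \<beta>t R xstar (y i) (lam i) (w i)) \<and>
      y (Suc i) = (1 - lam i) *\<^sub>R y i + lam i *\<^sub>R w i \<and>
      svd_calls (S (Suc i)) = 1 \<and> proj_calls (S (Suc i)) = 1 \<and> hess_calls (S (Suc i)) = 1 \<and>
      steps (S (Suc i)) \<le> 226 * (s * m * n)" for i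
  proof -
    have "y i \<in> edom R" using inv[of i] y by (simp add: invariant_def edom)
    moreover have "0 \<le> lam i" "lam i \<le> 1" using lam by auto
    ultimately show ?thesis
      using body_correct[OF inv[of i], of "lam i", folded SSuc] unfolding gradQ
      using y w by simp
  qed
  have "y 0 = xt" using init(2) y by simp
  with init(3-6) step
  show "y 0 = xt \<and> svd_calls (S 0) = 0 \<and> proj_calls (S 0) = 0 \<and> hess_calls (S 0) = 0 \<and>
      steps (S 0) \<le> 226 * (s * m * n) \<and>
      (\<forall>i. y i \<in> edom R \<and>
        (0 < lam i \<longrightarrow> low_rank_step m n s K gradQ \<beta>t R (y i) (lam i) (w i) \<and>
           wpo_output gradQ \<beta>t R xstar (y i) (lam i) (w i)) \<and>
        y (Suc i) = (1 - lam i) *\<^sub>R y i + lam i *\<^sub>R w i \<and>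
        svd_calls (S (Suc i)) = 1 \<and> proj_calls (S (Suc i)) = 1 \<and> hess_calls (S (Suc i)) = 1 \<and>
        steps (S (Suc i)) \<le> 226 * (s * m * n))" by blast
qed

end
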